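(* The following conclusions hold. (1) For all but countably many $\varphi\in(0,\pi)$, the side involutions of a very general hyperbolic triangle with area $\varphi$ generate the Coxeter group $W=\mathbb{Z}_2*\mathbb{Z}_2*\mathbb{Z}_2$; that is, for all $\eta$ in some dense $G_\delta$ subset of $\mathfrak{T}_\varphi$ the homomorphism $\sigma_\eta\colon W\to\mathrm{PSL}(2,\mathbb{R})$ is injective. (2) If $\varphi\in(0,\pi)$ is an irrational multiple of $\pi$, then for a dense set of $\eta\in\mathfrak{T}_\varphi$ the side involutions admit a (nontrivial) relation which is the product of two involutions in $W$; that is, there is $1\ne u\in\ker\sigma_\eta$ which is a product of two elements of order two in $W$.
   Context: $W=\langle P,Q,R\mid P^2=Q^2=R^2=1\rangle\cong\mathbb{Z}_2*\mathbb{Z}_2*\mathbb{Z}_2$. For $\varphi\in(0,\pi)$ the space of hyperbolic triangles $ABC$ of area $\varphi$ is identified with the space of interior angles $$\mathfrak{T}_\varphi=\{(\theta_A,\theta_B,\theta_C)\in(0,\pi)^3\mid\theta_A+\theta_B+\theta_C=\pi-\varphi\}$$ with the subspace topology. The side involutions of a geodesic triangle in $\mathbb{H}^2$ are the rotations by angle $\pi$ about the midpoints of its three sides. For $\eta=(\theta_A,\theta_B,\theta_C)\in\mathfrak{T}_\varphi$, choose a geodesic triangle in $\mathbb{H}^2$ with vertices $O_A,O_B,O_C$ and interior angles $\theta_A,\theta_B,\theta_C$ there (unique up to isometry); $\sigma_\eta\colon W\to\mathrm{PSL}(2,\mathbb{R})\cong\mathrm{Isom}_+(\mathbb{H}^2)$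 is the homomorphism sending $P,Q,R$ to the side involutions about the midpoints of $O_BO_C$, $O_CO_A$, $O_AO_B$ respectively. A statement holds for a very general point of a topological space if it holds for all points of some dense $G_\delta$ subset. *)

theory Defs
  imports
    "HOL-Analysis.Analysis"
    "HOL-Algebra.Multiplicative_Group"
begin

datatype gen = GP | GQ | GR

text \<open>Since the relations make every generator its own inverse, words in the
  generators suffice: \<open>W\<close> is the set of all words modulo the smallest congruence that
  identifies \<open>x\<^sup>2\<close> with the empty word for each generator \<open>x\<close>.\<close>

inductive weq :: "gen list \<Rightarrow> gen list \<Rightarrow> bool" where
  refl: "weq u u"
| sym: "weq u v \<Longrightarrow> weq v u"
| trans: "weq u v \<Longrightarrow> weq v w \<Longrightarrow> weq u w"
| cancel: "weq (u @ [x, x] @ v) (u @ v)"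

definition wclass :: "gen list \<Rightarrow> gen list set" where
  "wclass u = {v. weq u v}"

definition W :: "gen list set monoid" where
  "W = \<lparr>carrier = range wclass,
        mult = (\<lambda>X Y. \<Union>u\<in>X. \<Union>v\<in>Y. wclass (u @ v)),
        one = wclass []\<rparr>"

lemma wclass_eq_iff: "wclass u = wclass v \<longleftrightarrow> weq u v"
  unfolding wclass_def
  by (metis (mono_tags, lifting) mem_Collect_eq weq.refl weq.sym weq.trans Collect_cong)

lemma mem_wclass: "v \<in> wclass u \<longleftrightarrow> wclass v = wclass u"
  unfolding wclass_eq_iff by (auto simp: wclass_def intro: weq.sym)

lemma weq_append1: "weq u v \<Longrightarrow> weq (w @ u) (w @ v)"
proof (induction rule: weq.induct)
  case (cancel u x v)
  show ?case using weq.cancel[of "w @ u" x v] by simp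
qed (blast intro: weq.intros)+

lemma weq_append2: "weq u v \<Longrightarrow> weq (u @ w) (v @ w)"
proof (induction rule: weq.induct)
  case (cancel u x v)
  show ?case using weq.cancel[of u x "v @ w"] by simp
qed (blast intro: weq.intros)+

lemma carrier_W: "carrier W = range wclass"
  by (simp add: W_def)

lemma one_W: "\<one>\<^bsub>W\<^esub> = wclass []"
  by (simp add: W_def)

lemma mult_W: "wclass u \<otimes>\<^bsub>W\<^esub> wclass v = wclass (u @ v)"
proof -
  have "wclass (u' @ v') = wclass (u @ v)" if "u' \<in> wclass u" "v' \<in> wclass v" for u' v'
  proof -
    have "weq (u' @ v') (u' @ v)" "weq (u' @ v) (u @ v)"
      using that by (simp_all add: mem_wclass wclass_eq_iff weq_append1 weq_append2)
    then show ?thesis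
      unfolding wclass_eq_iff by (rule weq.trans)
  qed
  then have "(\<Union>u'\<in>wclass u. \<Union>v'\<in>wclass v. wclass (u' @ v'))
      = (\<Union>u'\<in>wclass u. \<Union>v'\<in>wclass v. wclass (u @ v))"
    by simp
  moreover have "u \<in> wclass u" "v \<in> wclass v"
    by (simp_all add: mem_wclass)
  ultimately show ?thesis
    unfolding W_def by auto
qed

lemma weq_rev: "weq (rev u @ u) []"
proof (induction u)
  case (Cons x u)
  have "weq (rev (x # u) @ x # u) (rev u @ u)"
    using weq.cancel[of "rev u" x u] by simp
  then show ?case using Cons weq.trans by blast
qed (simp add: weq.refl)

lemma group_W: "group W"
proof (rule groupI)
  fix X assume "X \<in> carrier W"
  then obtain u where u: "X = wclass u" by (auto simp: carrier_W)
  have "wclass (rev u) \<otimes>\<^bsub>W\<^esub> X = \<one>\<^bsub>W\<^esub>"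
    using weq_rev by (simp add: u mult_W one_W wclass_eq_iff)
  then show "\<exists>Y\<in>carrier W. Y \<otimes>\<^bsub>W\<^esub> X = \<one>\<^bsub>W\<^esub>"
    unfolding carrier_W by blast
next
  fix X Y Z assume "X \<in> carrier W" "Y \<in> carrier W" "Z \<in> carrier W"
  then obtain u v w where "X = wclass u" "Y = wclass v" "Z = wclass w"
    unfolding carrier_W by blast
  then show "X \<otimes>\<^bsub>W\<^esub> Y \<otimes>\<^bsub>W\<^esub> Z = X \<otimes>\<^bsub>W\<^esub> (Y \<otimes>\<^bsub>W\<^esub> Z)"
    by (simp add: mult_W)
next
  fix X Y assume "X \<in> carrier W" "Y \<in> carrier W"
  then obtain u v where "X = wclass u" "Y = wclass v"
    unfolding carrier_W by blast
  then show "X \<otimes>\<^bsub>W\<^esub> Y \<in> carrier W"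
    by (simp add: mult_W carrier_W)
next
  fix X assume "X \<in> carrier W"
  then obtain u where "X = wclass u"
    unfolding carrier_W by blast
  then show "\<one>\<^bsub>W\<^esub> \<otimes>\<^bsub>W\<^esub> X = X"
    by (simp add: mult_W one_W)
qed (simp add: carrier_W one_W)

definition SL2R :: "(real^2^2) monoid" where
  "SL2R = \<lparr>carrier = {g. det g = 1}, mult = (**), one = mat 1\<rparr>"

definition PSL2R :: "(real^2^2) set monoid" where
  "PSL2R = SL2R Mod {mat 1, - mat 1}"

lemma group_SL2R: "group SL2R"
proof (rule groupI)
  fix g assume "g \<in> carrier SL2R"
  then have g: "det g = 1" by (simp add: SL2R_def)
  then have "invertible g" by (simp add: invertible_det_nz)
  then obtain h where inv: "h ** g = mat 1"
    unfolding invertible_def by blast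
  moreover have "det h = 1"
    using arg_cong[OF inv, of det] g by (simp add: det_mul)
  ultimately show "\<exists>h\<in>carrier SL2R. h \<otimes>\<^bsub>SL2R\<^esub> g = \<one>\<^bsub>SL2R\<^esub>"
    by (auto simp: SL2R_def)
qed (auto simp: SL2R_def det_mul matrix_mul_assoc)

lemma minus_mat_mult: "- mat 1 ** (g :: real^2^2) = - g" "(g :: real^2^2) ** - mat 1 = - g"
  by (simp_all add: matrix_matrix_mult_def mat_def vec_eq_iff sum_2 forall_2)

lemma center_subgroup: "subgroup {mat 1, - mat 1} SL2R"
proof (rule group.subgroupI[OF group_SL2R])
  have "det (- mat 1 :: real^2^2) = 1"
    by (simp add: det_2 mat_def)
  then show sub: "{mat 1, - mat 1} \<subseteq> carrier SL2R"
    by (auto simp: SL2R_def)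
  fix a b assume a: "a \<in> {mat 1, - mat 1 :: real^2^2}" and b: "b \<in> {mat 1, - mat 1 :: real^2^2}"
  show "a \<otimes>\<^bsub>SL2R\<^esub> b \<in> {mat 1, - mat 1}"
    using a b by (auto simp: SL2R_def minus_mat_mult)
  have "a \<otimes>\<^bsub>SL2R\<^esub> a = \<one>\<^bsub>SL2R\<^esub>" "a \<in> carrier SL2R"
    using a sub by (auto simp: SL2R_def minus_mat_mult)
  then have "inv\<^bsub>SL2R\<^esub> a = a"
    using group.inv_equality[OF group_SL2R] by blast
  then show "inv\<^bsub>SL2R\<^esub> a \<in> {mat 1, - mat 1}" using a by simp
qed simp

lemma SL2R_rcoset: "{mat 1, - mat 1} #>\<^bsub>SL2R\<^esub> g = {g, - g}"
  by (simp add: r_coset_def SL2R_def minus_mat_mult insert_commute)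

lemma normal_center: "{mat 1, - mat 1} \<lhd> SL2R"
  by (rule group.normalI[OF group_SL2R center_subgroup])
    (auto simp: r_coset_def l_coset_def SL2R_def minus_mat_mult)

lemma group_PSL2R: "group PSL2R"
  unfolding PSL2R_def by (rule normal.factorgroup_is_group[OF normal_center])

lemma carrier_PSL2R: "carrier PSL2R = {{g, - g} | g. det g = 1}"
  unfolding PSL2R_def carrier_FactGroup SL2R_rcoset by (auto simp: SL2R_def)

lemma one_PSL2R: "\<one>\<^bsub>PSL2R\<^esub> = {mat 1, - mat 1}"
  by (simp add: PSL2R_def)

text \<open>We use the upper half-plane model with curvature \<open>-1\<close>.\<close>

definition H2 :: "complex set" where
  "H2 = {z. Im z > 0}"

definition hdist :: "complex \<Rightarrow> complex \<Rightarrow> real" where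
  "hdist z w = arcosh (1 + (cmod (z - w))\<^sup>2 / (2 * Im z * Im w))"

text \<open>\<open>hsegment \<gamma> p q\<close>: \<open>\<gamma>\<close> parametrises the geodesic segment from \<open>p\<close> to \<open>q\<close>
  by arc length on \<open>{0..hdist p q}\<close>.\<close>

definition hsegment :: "(real \<Rightarrow> complex) \<Rightarrow> complex \<Rightarrow> complex \<Rightarrow> bool" where
  "hsegment \<gamma> p q \<longleftrightarrow>
     \<gamma> 0 = p \<and> \<gamma> (hdist p q) = q \<and> \<gamma> ` {0..hdist p q} \<subseteq> H2 \<and>
     (\<forall>s\<in>{0..hdist p q}. \<forall>t\<in>{0..hdist p q}. hdist (\<gamma> s) (\<gamma> t) = \<bar>s - t\<bar>)"

text \<open>Initial velocity at \<open>p\<close> of the geodesic segment from \<open>p\<close> to \<open>q\<close>, for \<open>p \<noteq> q\<close>.\<close>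

definition hdir :: "complex \<Rightarrow> complex \<Rightarrow> complex" where
  "hdir p q = (THE v. \<exists>\<gamma>. hsegment \<gamma> p q \<and>
     (\<gamma> has_vector_derivative v) (at 0 within {0..hdist p q}))"

text \<open>Angle at \<open>p\<close> between the segments to \<open>q\<close> and to \<open>r\<close>. The hyperbolic metric is a
  pointwise multiple of the Euclidean one, so angles are Euclidean angles between velocities.\<close>

definition hangle :: "complex \<Rightarrow> complex \<Rightarrow> complex \<Rightarrow> real" where
  "hangle p q r =
     arccos (inner (hdir p q) (hdir p r) / (norm (hdir p q) * norm (hdir p r)))"

definition hmidpoint :: "complex \<Rightarrow> complex \<Rightarrow> complex" where
  "hmidpoint p q = (THE m. m \<in> H2 \<and> hdist p m = hdist p q / 2 \<and> hdist m q = hdist p q / 2)"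

definition mob :: "real^2^2 \<Rightarrow> complex \<Rightarrow> complex" where
  "mob g z = (of_real (g$1$1) * z + of_real (g$1$2)) / (of_real (g$2$1) * z + of_real (g$2$2))"

text \<open>Orientation-preserving isometries are identified with elements of \<open>PSL2R\<close> via
  \<^const>\<open>mob\<close>; the rotation by \<open>\<alpha>\<close> about \<open>m\<close> is the one that fixes \<open>m\<close> with derivative
  \<open>exp (\<i> \<alpha>)\<close> there.\<close>

definition hrotation :: "real \<Rightarrow> complex \<Rightarrow> (real^2^2) set" where
  "hrotation \<alpha> m = (THE X. X \<in> carrier PSL2R \<and>
     (\<forall>g\<in>X. mob g m = m \<and> (mob g has_field_derivative cis \<alpha>) (at m)))"

lemma mob_minus: "mob (- g) = mob g"
proof
  fix z
  have "mob (- g) z = (- (of_real (g$1$1) * z + of_real (g$1$2))) /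
      (- (of_real (g$2$1) * z + of_real (g$2$2)))"
    by (simp add: mob_def)
  also have "\<dots> = mob g z"
    unfolding minus_divide_divide by (simp add: mob_def)
  finally show "mob (- g) z = mob g z" .
qed

lemma mob_denom_nonzero:
  fixes g :: "real^2^2"
  assumes "det g = 1" "m \<in> H2"
  shows "of_real (g$2$1) * m + of_real (g$2$2) \<noteq> 0"
proof
  assume "of_real (g$2$1) * m + of_real (g$2$2) = 0"
  then have "g$2$1 * Im m = 0" "g$2$1 * Re m + g$2$2 = 0"
    by (simp_all add: complex_eq_iff)
  with assms show False
    by (auto simp: H2_def det_2)
qed

lemma mob_deriv:
  assumes "det g = 1" "m \<in> H2"
  shows "(mob g has_field_derivative 1 / (of_real (g$2$1) * m + of_real (g$2$2))\<^sup>2) (at m)"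
proof -
  define a b c d where "a = g$1$1" and "b = g$1$2" and "c = g$2$1" and "d = g$2$2"
  have nz: "of_real c * m + of_real d \<noteq> 0"
    using mob_denom_nonzero[OF assms] by (simp add: c_def d_def)
  have "a * d - b * c = 1"
    using assms by (simp add: det_2 a_def b_def c_def d_def)
  then have abcd: "of_real a * of_real d - of_real b * of_real c = (1 :: complex)"
    by (metis of_real_1 of_real_diff of_real_mult)
  have "((\<lambda>z. (of_real a * z + of_real b) / (of_real c * z + of_real d)) has_field_derivative
      (of_real a * (of_real c * m + of_real d) - (of_real a * m + of_real b) * of_real c) /
      ((of_real c * m + of_real d) * (of_real c * m + of_real d))) (at m)"
    by (rule derivative_eq_intros refl nz | simp)+
  also have "of_real a * (of_real c * m + of_real d) - (of_real a * m + of_real b) * of_real c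
      = (1 :: complex)"
    using abcd by (simp add: algebra_simps)
  finally show ?thesis
    unfolding mob_def a_def b_def c_def d_def power2_eq_square .
qed

definition half_turn_matrix :: "complex \<Rightarrow> real^2^2" where
  "half_turn_matrix m = vector
     [vector [Re m / Im m, - ((Re m)\<^sup>2 + (Im m)\<^sup>2) / Im m], vector [1 / Im m, - Re m / Im m]]"

lemma half_turn_matrix_nth [simp]:
  "half_turn_matrix m $ 1 $ 1 = Re m / Im m"
  "half_turn_matrix m $ 1 $ 2 = - ((Re m)\<^sup>2 + (Im m)\<^sup>2) / Im m"
  "half_turn_matrix m $ 2 $ 1 = 1 / Im m"
  "half_turn_matrix m $ 2 $ 2 = - Re m / Im m"
  by (simp_all add: half_turn_matrix_def)

lemma det_half_turn_matrix: "m \<in> H2 \<Longrightarrow> det (half_turn_matrix m) = 1"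
  by (simp add: H2_def det_2 field_simps power2_eq_square)

lemma half_turn_matrix_square: "m \<in> H2 \<Longrightarrow> half_turn_matrix m ** half_turn_matrix m = - mat 1"
  by (simp add: H2_def vec_eq_iff forall_2 matrix_matrix_mult_def sum_2 mat_def
      field_simps power2_eq_square)

lemma half_turn_iff:
  assumes "det g = 1" "m \<in> H2"
  shows "mob g m = m \<and> (mob g has_field_derivative cis pi) (at m) \<longleftrightarrow>
         g = half_turn_matrix m \<or> g = - half_turn_matrix m"
proof -
  define a b c d x y where abcdxy: "a = g$1$1" "b = g$1$2" "c = g$2$1" "d = g$2$2"
    "x = Re m" "y = Im m"
  have y: "y > 0" using assms by (simp add: H2_def abcdxy)
  define D where "D = of_real c * m + of_real d"
  have D: "D \<noteq> 0" using mob_denom_nonzero[OF assms] by (simp add: D_def abcdxy)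
  have Dparts: "Re D = c * x + d" "Im D = c * y"
    by (simp_all add: D_def abcdxy)
  have "(mob g has_field_derivative cis pi) (at m) \<longleftrightarrow> cis pi = 1 / D\<^sup>2"
    using mob_deriv[OF assms] DERIV_unique unfolding D_def abcdxy by metis
  also have "\<dots> \<longleftrightarrow> D\<^sup>2 = - 1"
  proof -
    have "cis pi = 1 / D\<^sup>2 \<longleftrightarrow> - (D\<^sup>2) = 1"
      using D by (simp add: field_simps)
    also have "\<dots> \<longleftrightarrow> D\<^sup>2 = - 1"
      by (metis minus_minus)
    finally show ?thesis .
  qed
  also have "\<dots> \<longleftrightarrow> D = \<i> \<or> D = - \<i>"
    by (metis i_squared power2_eq_iff power2_i)
  finally have der: "(mob g has_field_derivative cis pi) (at m) \<longleftrightarrow> D = \<i> \<or> D = - \<i>" .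
  have "mob g m = m \<longleftrightarrow> of_real a * m + of_real b = m * D"
    using D by (simp add: mob_def D_def abcdxy field_simps)
  then have fixpt: "mob g m = m \<longleftrightarrow>
      a * x + b = x * (c * x + d) - y * (c * y) \<and> a * y = x * (c * y) + y * (c * x + d)"
    by (simp add: complex_eq_iff Dparts) (simp add: abcdxy)
  have mat: "g = half_turn_matrix m \<longleftrightarrow>
      a = x / y \<and> b = - (x\<^sup>2 + y\<^sup>2) / y \<and> c = 1 / y \<and> d = - x / y"
    by (auto simp: vec_eq_iff forall_2 abcdxy)
  have mat': "g = - half_turn_matrix m \<longleftrightarrow>
      a = - x / y \<and> b = (x\<^sup>2 + y\<^sup>2) / y \<and> c = - 1 / y \<and> d = x / y"
    using y by (auto simp: vec_eq_iff forall_2 abcdxy field_simps)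
  have plus: "mob g m = m \<and> D = \<i> \<longleftrightarrow> g = half_turn_matrix m"
  proof
    assume *: "mob g m = m \<and> D = \<i>"
    then have 1: "c * x + d = 0" "c * y = 1" using Dparts by auto
    with * fixpt have 2: "a * x + b = - y" "a * y = x" by auto
    have c: "c = 1 / y" and a: "a = x / y" using 1 2 y by (simp_all add: field_simps)
    have d: "d = - x / y" using 1(1) by (simp add: c)
    have "b = - y - x * x / y" using 2(1) by (simp add: a)
    then have b: "b = - (x\<^sup>2 + y\<^sup>2) / y" using y by (simp add: field_simps power2_eq_square)
    show "g = half_turn_matrix m" using mat a b c d by blast
  next
    assume "g = half_turn_matrix m"
    note abcd = this[unfolded mat]
    have "mob g m = m"
      unfolding fixpt using y by (simp add: abcd field_simps power2_eq_square)
    moreover have "D = \<i>"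
      unfolding complex_eq_iff Dparts using y by (simp add: abcd)
    ultimately show "mob g m = m \<and> D = \<i>" ..
  qed
  have minus: "mob g m = m \<and> D = - \<i> \<longleftrightarrow> g = - half_turn_matrix m"
  proof
    assume *: "mob g m = m \<and> D = - \<i>"
    then have 1: "c * x + d = 0" "c * y = - 1" using Dparts by auto
    with * fixpt have 2: "a * x + b = y" "a * y = - x" by auto
    have c: "c = - 1 / y" and a: "a = - x / y" using 1 2 y by (simp_all add: field_simps)
    have d: "d = x / y" using 1(1) by (simp add: c)
    have "b = y + x * x / y" using 2(1) by (simp add: a)
    then have b: "b = (x\<^sup>2 + y\<^sup>2) / y" using y by (simp add: field_simps power2_eq_square)
    show "g = - half_turn_matrix m" using mat' a b c d by blast
  next
    assume "g = - half_turn_matrix m"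
    note abcd = this[unfolded mat']
    have "mob g m = m"
      unfolding fixpt using y by (simp add: abcd field_simps power2_eq_square)
    moreover have "D = - \<i>"
      unfolding complex_eq_iff Dparts using y by (simp add: abcd)
    ultimately show "mob g m = m \<and> D = - \<i>" ..
  qed
  show ?thesis using der plus minus by blast
qed

lemma hrotation_pi:
  assumes "m \<in> H2"
  shows "hrotation pi m = {half_turn_matrix m, - half_turn_matrix m}"
  unfolding hrotation_def
proof (rule the_equality)
  have "det (- half_turn_matrix m) = 1"
    using det_half_turn_matrix[OF assms] by (simp add: det_2)
  then show "{half_turn_matrix m, - half_turn_matrix m} \<in> carrier PSL2R \<and>
      (\<forall>g\<in>{half_turn_matrix m, - half_turn_matrix m}.
        mob g m = m \<and> (mob g has_field_derivative cis pi) (at m))"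
    using half_turn_iff[OF _ assms, of "half_turn_matrix m"]
      half_turn_iff[OF _ assms, of "- half_turn_matrix m"] det_half_turn_matrix[OF assms]
    unfolding carrier_PSL2R by blast
next
  fix X assume "X \<in> carrier PSL2R \<and>
    (\<forall>g\<in>X. mob g m = m \<and> (mob g has_field_derivative cis pi) (at m))"
  then obtain g where "X = {g, - g}" "det g = 1"
    "mob g m = m" "(mob g has_field_derivative cis pi) (at m)"
    unfolding carrier_PSL2R by blast
  moreover from this have "g = half_turn_matrix m \<or> g = - half_turn_matrix m"
    using half_turn_iff[OF _ assms, of g] by blast
  ultimately show "X = {half_turn_matrix m, - half_turn_matrix m}"
    by (elim disjE) (simp_all add: insert_commute)
qed

definition triangle_angles :: "real \<Rightarrow> (real \<times> real \<times> real) set" where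
  "triangle_angles \<phi> = {(a, b, c). a \<in> {0<..<pi} \<and> b \<in> {0<..<pi} \<and> c \<in> {0<..<pi} \<and>
     a + b + c = pi - \<phi>}"

text \<open>Distinctness keeps \<^const>\<open>hdir\<close> meaningful; for angles in \<open>{0<..<pi}\<close> it also
  excludes collinear vertices, whose angles are \<open>0\<close> or \<open>pi\<close>.\<close>

definition has_angles ::
  "complex \<times> complex \<times> complex \<Rightarrow> real \<times> real \<times> real \<Rightarrow> bool" where
  "has_angles = (\<lambda>(A, B, C) (a, b, c).
     A \<in> H2 \<and> B \<in> H2 \<and> C \<in> H2 \<and> A \<noteq> B \<and> B \<noteq> C \<and> C \<noteq> A \<and>
     hangle A B C = a \<and> hangle B C A = b \<and> hangle C A B = c)"

fun side_involution :: "complex \<times> complex \<times> complex \<Rightarrow> gen \<Rightarrow> (real^2^2) set" where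
  "side_involution (A, B, C) GP = hrotation pi (hmidpoint B C)"
| "side_involution (A, B, C) GQ = hrotation pi (hmidpoint C A)"
| "side_involution (A, B, C) GR = hrotation pi (hmidpoint A B)"

definition word_value :: "(gen \<Rightarrow> (real^2^2) set) \<Rightarrow> gen list \<Rightarrow> (real^2^2) set" where
  "word_value f w = foldr (\<lambda>x g. f x \<otimes>\<^bsub>PSL2R\<^esub> g) w \<one>\<^bsub>PSL2R\<^esub>"

text \<open>The homomorphism from \<open>W\<close> to \<open>PSL2R\<close> that extends \<open>f\<close>, provided that \<open>f\<close> maps the
  generators to elements of square \<open>1\<close>; see the lemmas below.\<close>

definition rep_of :: "(gen \<Rightarrow> (real^2^2) set) \<Rightarrow> gen list set \<Rightarrow> (real^2^2) set" where
  "rep_of f X = the_elem (word_value f ` X)"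

text \<open>A triangle is determined by its angles up to isometry, so the choice affects
  \<open>side_hom \<eta>\<close> only by conjugation with an isometry and does not affect its kernel.\<close>

definition side_hom :: "real \<times> real \<times> real \<Rightarrow> gen list set \<Rightarrow> (real^2^2) set" where
  "side_hom \<eta> = rep_of (side_involution (SOME T. has_angles T \<eta>))"

context
  fixes f :: "gen \<Rightarrow> (real^2^2) set"
  assumes closed: "\<And>x. f x \<in> carrier PSL2R"
    and square: "\<And>x. f x \<otimes>\<^bsub>PSL2R\<^esub> f x = \<one>\<^bsub>PSL2R\<^esub>"
begin

interpretation PSL: group PSL2R by (rule group_PSL2R)

lemma word_value_closed: "word_value f w \<in> carrier PSL2R"
  by (induction w) (auto simp: word_value_def closed)

lemma word_value_append: "word_value f (u @ v) = word_value f u \<otimes>\<^bsub>PSL2R\<^esub> word_value f v"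
proof (induction u)
  case Nil
  show ?case using word_value_closed[of v] by (simp add: word_value_def)
next
  case (Cons x u)
  then show ?case
    using PSL.m_assoc[OF closed[of x] word_value_closed[of u] word_value_closed[of v]]
    by (simp add: word_value_def)
qed

lemma word_value_weq: "weq u v \<Longrightarrow> word_value f u = word_value f v"
proof (induction rule: weq.induct)
  case (cancel u x v)
  have "word_value f [x, x] = \<one>\<^bsub>PSL2R\<^esub>"
    using closed square by (simp add: word_value_def)
  then show ?case
    using word_value_closed by (simp only: word_value_append PSL.l_one)
qed auto

lemma rep_of_wclass: "rep_of f (wclass w) = word_value f w"
proof -
  have "word_value f ` wclass w = {word_value f w}"
    using word_value_weq weq.refl unfolding wclass_def by fastforce
  then show ?thesis by (simp add: rep_of_def)
qed

lemma rep_of_hom: "rep_of f \<in> hom W PSL2R"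
proof (rule homI)
  fix X Y assume "X \<in> carrier W" "Y \<in> carrier W"
  then obtain u v where "X = wclass u" "Y = wclass v"
    unfolding carrier_W by blast
  then show "rep_of f (X \<otimes>\<^bsub>W\<^esub> Y) = rep_of f X \<otimes>\<^bsub>PSL2R\<^esub> rep_of f Y"
    by (simp add: mult_W rep_of_wclass word_value_append)
next
  fix X assume "X \<in> carrier W"
  then obtain u where "X = wclass u"
    unfolding carrier_W by blast
  then show "rep_of f X \<in> carrier PSL2R"
    by (simp add: rep_of_wclass word_value_closed)
qed

lemma rep_of_gen: "rep_of f (wclass [x]) = f x"
  using closed by (simp add: rep_of_wclass word_value_def)

end

lemma hrotation_pi_closed: "m \<in> H2 \<Longrightarrow> hrotation pi m \<in> carrier PSL2R"
  using det_half_turn_matrix by (auto simp: hrotation_pi carrier_PSL2R)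

lemma hrotation_pi_square:
  assumes "m \<in> H2"
  shows "hrotation pi m \<otimes>\<^bsub>PSL2R\<^esub> hrotation pi m = \<one>\<^bsub>PSL2R\<^esub>"
proof -
  let ?h = "half_turn_matrix m"
  have "hrotation pi m = {mat 1, - mat 1} #>\<^bsub>SL2R\<^esub> ?h"
    by (simp add: hrotation_pi[OF assms] SL2R_rcoset)
  moreover have "?h \<in> carrier SL2R"
    by (simp add: SL2R_def det_half_turn_matrix[OF assms])
  ultimately have "hrotation pi m \<otimes>\<^bsub>PSL2R\<^esub> hrotation pi m =
      {mat 1, - mat 1} #>\<^bsub>SL2R\<^esub> (?h \<otimes>\<^bsub>SL2R\<^esub> ?h)"
    using normal.rcos_sum[OF normal_center] by (simp add: PSL2R_def)
  also have "\<dots> = \<one>\<^bsub>PSL2R\<^esub>"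
    unfolding SL2R_rcoset by (auto simp: SL2R_def half_turn_matrix_square[OF assms] one_PSL2R)
  finally show ?thesis .
qed

definition dense_in_space :: "'a topology \<Rightarrow> 'a set \<Rightarrow> bool" where
  "dense_in_space X S \<longleftrightarrow> X closure_of S = topspace X"

definition very_general :: "'a topology \<Rightarrow> ('a \<Rightarrow> bool) \<Rightarrow> bool" where
  "very_general X P \<longleftrightarrow> (\<exists>D. gdelta_in X D \<and> dense_in_space X D \<and> (\<forall>x\<in>D. P x))"

end

(* In the hyperboloid model the side involutions act on the vectors B + C, C + A, A + B by the
   matrices of the geometric representation of the Coxeter group W, up to sign, with parameters
   1 + cos phi + sin phi cot theta for the angles theta. For an equilateral triangle of area phi
   all parameters equal x = 1 + 2 cos ((pi - phi) / 3), and the entries of a word are polynomials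
   in x. At x = -2 no reduced word is trivial, so each word kills equilateral triangles of only
   finitely many areas. For every other area, the triangles killed by a given word form a closed
   set, nowhere dense by analytic continuation along segments to the equilateral triangle, and
   Baire's theorem applies.

   For the second part, the products QPR, RQP, PRQ are rotations about the vertices A, B, C by
   pi - phi, while the rotations about A, B, C by twice the angles of the triangle have product 1.
   If (pi - phi) / pi is irrational, the latter are powers of the former for a dense set of
   triangles. This gives a relator w, and (w R w^-1) R is then a relator that is a product of two
   involutions. *)
theory Submission
  imports
    Defs
    "HOL-Analysis.Kronecker_Approximation_Theorem"
    "HOL-Complex_Analysis.Conformal_Mappings"
begin

section \<open>The hyperboloid model\<close>

text \<open>Two features favour conjugation on traceless matrices over the matrices themselves: it
  does not see the sign in PSL(2,R), and the square roots that normalise the midpoints cancel. A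
  word thus acts by polynomials in three parameters, each given by the area and one angle, and no
  triangle has to be followed while the angles vary. The obstacle is to find, for a fixed area, one
  triangle that a given word does not kill. With all parameters equal to x, the negated generators
  are v -> v - 2 B(v, e) e with B(e, e) = 1 and B(e, e') = x/2. So x = -2 is B(e, e') = -1, the
  geometric representation with all orders infinite, which is faithful. No equilateral triangle has
  this parameter, but a polynomial links the two. In the second part two angles are approximated
  independently by multiples of (pi - phi)/2 modulo pi; the angle sum forces the third.\<close>

text \<open>A point is encoded by its half-turn, a traceless matrix of determinant \<open>1\<close>. On traceless
  matrices \<open>mform\<close> is the Minkowski form polarising \<open>det\<close>, and it equals \<open>cosh\<close> of the distance on
  points. Geodesics and midpoints become linear combinations.\<close>

abbreviation J :: "complex \<Rightarrow> real^2^2" where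
  "J \<equiv> half_turn_matrix"

definition mform :: "real^2^2 \<Rightarrow> real^2^2 \<Rightarrow> real" where
  "mform M N = - (M$1$1 * N$1$1 + (M$1$2 * N$2$1 + M$2$1 * N$1$2) / 2)"

lemma mform_commute: "mform M N = mform N M"
  by (simp add: mform_def)

lemma mform_linear:
  "mform (M + M') N = mform M N + mform M' N"
  "mform (M - M') N = mform M N - mform M' N"
  "mform (r *\<^sub>R M) N = r * mform M N"
  "mform N (M + M') = mform N M + mform N M'"
  "mform N (M - M') = mform N M - mform N M'"
  "mform N (r *\<^sub>R M) = r * mform N M"
  by (simp_all add: mform_def field_simps)

definition hpoint :: "real^2^2 \<Rightarrow> complex" where
  "hpoint M = Complex (M$1$1 / M$2$1) (1 / M$2$1)"

lemma mat2_eq_iff: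
  "M = (N :: real^2^2) \<longleftrightarrow>
    M$1$1 = N$1$1 \<and> M$1$2 = N$1$2 \<and> M$2$1 = N$2$1 \<and> M$2$2 = N$2$2"
  by (auto simp: vec_eq_iff forall_2)

lemma matrix_mult_nth:
  "((M :: real^2^2) ** N) $ i $ j = M$i$1 * N$1$j + M$i$2 * N$2$j"
  by (simp add: matrix_matrix_mult_def sum_2)

lemma mat_nth:
  "(mat a :: real^2^2) $ 1 $ 1 = a" "(mat a :: real^2^2) $ 1 $ 2 = 0"
  "(mat a :: real^2^2) $ 2 $ 1 = 0" "(mat a :: real^2^2) $ 2 $ 2 = a"
  by (simp_all add: mat_def)

lemma hpoint:
  assumes "M$2$2 = - M$1$1" "mform M M = 1" "M$2$1 > 0"
  shows hpoint_in_H2: "hpoint M \<in> H2" and J_hpoint: "J (hpoint M) = M"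
proof -
  show "hpoint M \<in> H2" using assms(3) by (simp add: H2_def hpoint_def)
  have M12: "M$1$2 = - ((M$1$1)\<^sup>2 + 1) / M$2$1"
    using assms(2,3) by (simp add: mform_def field_simps power2_eq_square)
  show "J (hpoint M) = M"
    unfolding mat2_eq_iff using assms(1,3) by (simp add: M12 hpoint_def field_simps power2_eq_square)
qed

lemma hpoint_J: "z \<in> H2 \<Longrightarrow> hpoint (J z) = z"
  by (simp add: hpoint_def complex_eq_iff H2_def)

lemma J_inj: "\<lbrakk>z \<in> H2; w \<in> H2; J z = J w\<rbrakk> \<Longrightarrow> z = w"
  by (metis hpoint_J)

lemma mform_J:
  assumes "z \<in> H2" "w \<in> H2"
  shows "mform (J z) (J w) = 1 + (cmod (z - w))\<^sup>2 / (2 * Im z * Im w)"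
  using assms unfolding cmod_power2
  by (simp add: mform_def H2_def field_simps power2_eq_square)

lemma mform_J_self: "z \<in> H2 \<Longrightarrow> mform (J z) (J z) = 1"
  by (simp add: mform_J)

lemma mform_J_ge_1: "\<lbrakk>z \<in> H2; w \<in> H2\<rbrakk> \<Longrightarrow> mform (J z) (J w) \<ge> 1"
  by (simp add: mform_J H2_def)

lemma mform_J_gt_1: "\<lbrakk>z \<in> H2; w \<in> H2; z \<noteq> w\<rbrakk> \<Longrightarrow> mform (J z) (J w) > 1"
  by (simp add: mform_J H2_def)

lemma hdist_eq: "\<lbrakk>z \<in> H2; w \<in> H2\<rbrakk> \<Longrightarrow> hdist z w = arcosh (mform (J z) (J w))"
  by (simp add: mform_J hdist_def)

lemma cosh_hdist: "\<lbrakk>z \<in> H2; w \<in> H2\<rbrakk> \<Longrightarrow> cosh (hdist z w) = mform (J z) (J w)"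
  by (simp add: hdist_eq mform_J_ge_1)

lemma hdist_pos: "\<lbrakk>z \<in> H2; w \<in> H2; z \<noteq> w\<rbrakk> \<Longrightarrow> hdist z w > 0"
  using mform_J_gt_1[of z w] by (simp add: hdist_eq)

lemma hdist_eqI:
  assumes "z \<in> H2" "w \<in> H2" "mform (J z) (J w) = cosh t" "t \<ge> 0"
  shows "hdist z w = t"
  using assms by (simp add: hdist_eq arcosh_cosh_real)

lemma J_trace: "J z $ 2 $ 2 = - J z $ 1 $ 1"
  by simp

text \<open>The form has signature (1, 2), so it is definite on the orthogonal complement of the
  timelike vector \<open>J p\<close>.\<close>

lemma null_orthogonal_imp_zero:
  assumes p: "p \<in> H2" and tr: "n$2$2 = - n$1$1" and "mform n n = 0" "mform n (J p) = 0"
  shows "n = 0"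
proof -
  define a b c where abc: "a = n$1$1" "b = - n$1$2" "c = n$2$1"
  define a' b' c' where abc': "a' = J p$1$1" "b' = - J p$1$2" "c' = J p$2$1"
  have c': "c' > 0" using p by (simp add: abc' H2_def)
  have 1: "b' * c' - a' * a' = 1" "b * c = a * a" "b * c' + b' * c = 2 * a * a'"
    using mform_J_self[OF p] assms(3,4) unfolding mform_def abc abc'
    by (simp_all add: algebra_simps del: half_turn_matrix_nth)
  have b': "b' > 0"
  proof -
    have "b' * c' > 0" using 1(1) zero_le_square[of a'] by linarith
    with c' show ?thesis by (simp add: zero_less_mult_iff)
  qed
  have "(b * c' - b' * c)\<^sup>2 = - 4 * (a * a)" using 1 by Groebner_Basis.algebra
  then have "a = 0"
    by (metis mult_eq_0_iff not_real_square_gt_zero mult_less_0_iff zero_le_power2 linorder_not_less neg_less_0_iff_less zero_less_numeral)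
  with 1 have "b * c = 0" "b * c' + b' * c = 0" by auto
  with b' c' have "b = 0" "c = 0" by auto
  with \<open>a = 0\<close> show ?thesis using tr by (simp add: mat2_eq_iff abc)
qed

text \<open>The difference \<open>n\<close> of the points is orthogonal to the span, hence to
  \<open>J w\<close>; both points have norm 1, so \<open>n\<close> is null. All uniqueness
  statements about segments and midpoints come from here.\<close>

lemma mform_span_eq:
  assumes "p \<in> H2" "z \<in> H2" "w \<in> H2"
    and w: "J w = k *\<^sub>R J p + l *\<^sub>R J q"
    and eq: "mform (J z) (J p) = mform (J w) (J p)" "mform (J z) (J q) = mform (J w) (J q)"
  shows "z = w"
proof -
  define n where "n = J z - J w"
  have np: "mform n (J p) = 0" and "mform n (J q) = 0"
    using eq by (simp_all add: n_def mform_linear)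
  then have nw: "mform n (J w) = 0"
    by (simp add: w mform_linear)
  have "J z = J w + n" by (simp add: n_def)
  then have "1 = 1 + 2 * mform n (J w) + mform n n"
    using mform_J_self[OF assms(2)] mform_J_self[OF assms(3)] mform_commute[of "J w" n]
    by (simp add: mform_linear)
  then have "mform n n = 0" using nw by simp
  then have "n = 0"
    using null_orthogonal_imp_zero[OF assms(1) _ _ np] by (simp add: n_def)
  then show ?thesis using J_inj assms by (simp add: n_def)
qed

section \<open>Geodesic segments, their directions, midpoints and angles\<close>

definition geo :: "complex \<Rightarrow> complex \<Rightarrow> real \<Rightarrow> complex" where
  "geo p q s = hpoint ((sinh (hdist p q - s) / sinh (hdist p q)) *\<^sub>R J p +
     (sinh s / sinh (hdist p q)) *\<^sub>R J q)"

text \<open>\<open>geo\<close> is the hyperbolic form of spherical linear interpolation. Divided by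
  the square of sinh L, the left side is the product of its points at \<open>s\<close> and
  \<open>t\<close>, so the identity expresses unit speed.\<close>

lemma hyperbolic_interpolation:
  fixes L s t :: real
  shows "sinh (L - s) * sinh (L - t) + sinh s * sinh t +
    (sinh (L - s) * sinh t + sinh s * sinh (L - t)) * cosh L = cosh (s - t) * (sinh L)\<^sup>2"
proof -
  have "(a * c - b * d) * (a * c' - b * d') + d * d' + ((a * c - b * d) * d' + d * (a * c' - b * d')) * b
      = (c * c' - d * d') * a\<^sup>2" if "b\<^sup>2 = a\<^sup>2 + 1" for a b c d c' d' :: real
    using that by Groebner_Basis.algebra
  from this[OF cosh_square_eq[of L]] show ?thesis unfolding sinh_diff cosh_diff .
qed

context
  fixes p q :: complex
  assumes p: "p \<in> H2" and q: "q \<in> H2" and pq: "p \<noteq> q"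
begin

lemma sinh_hdist_pos: "sinh (hdist p q) > 0"
  using hdist_pos[OF p q pq] by simp

lemma geo_hpoint:
  assumes "0 \<le> s" "s \<le> hdist p q"
  shows geo_in_H2: "geo p q s \<in> H2"
    and J_geo: "J (geo p q s) = (sinh (hdist p q - s) / sinh (hdist p q)) *\<^sub>R J p +
     (sinh s / sinh (hdist p q)) *\<^sub>R J q"
proof -
  define L where "L = hdist p q"
  define M where "M = (sinh (L - s) / sinh L) *\<^sub>R J p + (sinh s / sinh L) *\<^sub>R J q"
  have L: "sinh L > 0" using sinh_hdist_pos by (simp add: L_def)
  have pqL: "mform (J p) (J q) = cosh L" using cosh_hdist[OF p q] by (simp add: L_def)
  have "mform M M = (sinh (L - s) * sinh (L - s) + sinh s * sinh s +
    (sinh (L - s) * sinh s + sinh s * sinh (L - s)) * cosh L) / (sinh L)\<^sup>2"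
    using L by (simp add: M_def mform_linear mform_J_self p q mform_commute[of "J q" "J p"] pqL
        field_simps power2_eq_square)
  then have 1: "mform M M = 1"
    unfolding hyperbolic_interpolation using L by simp
  have 2: "M$2$2 = - M$1$1" by (simp add: M_def)
  have nn: "sinh (L - s) \<ge> 0" "sinh s \<ge> 0" "s > 0 \<or> L - s > 0"
    using assms hdist_pos[OF p q pq] by (auto simp: L_def)
  have 3: "M$2$1 > 0"
  proof (cases "s > 0")
    case True
    then have "sinh s / sinh L * (1 / Im q) > 0" using L q by (simp add: H2_def)
    moreover have "sinh (L - s) / sinh L * (1 / Im p) \<ge> 0" using L nn p by (simp add: H2_def)
    ultimately show ?thesis by (simp add: M_def)
  next
    case False
    with nn have "sinh (L - s) / sinh L * (1 / Im p) > 0" using L p by (simp add: H2_def)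
    moreover have "sinh s / sinh L * (1 / Im q) \<ge> 0" using L nn q by (simp add: H2_def)
    ultimately show ?thesis by (simp add: M_def)
  qed
  have "geo p q s = hpoint M" by (simp add: geo_def M_def L_def)
  then show "geo p q s \<in> H2" "J (geo p q s) = (sinh (hdist p q - s) / sinh (hdist p q)) *\<^sub>R J p +
     (sinh s / sinh (hdist p q)) *\<^sub>R J q"
    using hpoint[OF 2 1 3] by (simp_all add: M_def L_def)
qed

lemma geo_0: "geo p q 0 = p" and geo_end: "geo p q (hdist p q) = q"
  using sinh_hdist_pos by (simp_all add: geo_def hpoint_J p q)

lemma hdist_geo:
  assumes "0 \<le> s" "s \<le> hdist p q" "0 \<le> t" "t \<le> hdist p q"
  shows "hdist (geo p q s) (geo p q t) = \<bar>s - t\<bar>"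
proof (rule hdist_eqI)
  define L where "L = hdist p q"
  have L: "sinh L > 0" using sinh_hdist_pos by (simp add: L_def)
  have pqL: "mform (J p) (J q) = cosh L" using cosh_hdist[OF p q] by (simp add: L_def)
  have "mform (J (geo p q s)) (J (geo p q t)) = (sinh (L - s) * sinh (L - t) + sinh s * sinh t +
    (sinh (L - s) * sinh t + sinh s * sinh (L - t)) * cosh L) / (sinh L)\<^sup>2"
    using L assms by (simp add: J_geo mform_linear mform_J_self p q mform_commute[of "J q" "J p"] pqL
        flip: L_def) (simp add: field_simps power2_eq_square)
  then show "mform (J (geo p q s)) (J (geo p q t)) = cosh \<bar>s - t\<bar>"
    unfolding hyperbolic_interpolation using L by simp
qed (use assms geo_in_H2 in auto)

text \<open>The distances to both ends prescribe the products with \<open>J p\<close> and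
  \<open>J q\<close>. This identifies every unit-speed segment with \<open>geo\<close>, and the
  midpoint with its value at half length.\<close>

lemma geo_unique:
  assumes "0 \<le> s" "s \<le> hdist p q" "z \<in> H2" "hdist p z = s" "hdist z q = hdist p q - s"
  shows "z = geo p q s"
proof (rule mform_span_eq[OF p assms(3) geo_in_H2[OF assms(1,2)] J_geo[OF assms(1,2)]])
  have "hdist (geo p q 0) (geo p q s) = s" "hdist (geo p q s) (geo p q (hdist p q)) = hdist p q - s"
    using assms hdist_geo hdist_pos[OF p q pq] by auto
  then show "mform (J z) (J p) = mform (J (geo p q s)) (J p)"
    "mform (J z) (J q) = mform (J (geo p q s)) (J q)"
    using assms p q geo_in_H2[OF assms(1,2)] unfolding geo_0 geo_end
    by (metis cosh_hdist mform_commute)+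
qed

lemma hsegment_geo: "hsegment (geo p q) p q"
  unfolding hsegment_def using geo_0 geo_end geo_in_H2 hdist_geo by auto

lemma hsegment_unique:
  assumes "hsegment \<gamma> p q" "s \<in> {0..hdist p q}"
  shows "\<gamma> s = geo p q s"
proof (rule geo_unique)
  have *: "\<gamma> 0 = p" "\<gamma> (hdist p q) = q" "hdist (\<gamma> a) (\<gamma> b) = \<bar>a - b\<bar>"
    if "a \<in> {0..hdist p q}" "b \<in> {0..hdist p q}" for a b
    using assms that unfolding hsegment_def by blast+
  have 0: "0 \<in> {0..hdist p q}" "hdist p q \<in> {0..hdist p q}" using hdist_pos[OF p q pq] by auto
  show "hdist p (\<gamma> s) = s" "hdist (\<gamma> s) q = hdist p q - s"
    using *(3)[OF 0(1) assms(2)] *(3)[OF assms(2) 0(2)] assms unfolding *(1,2)[OF 0] by auto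
qed (use assms in \<open>auto simp: hsegment_def\<close>)

text \<open>Unit initial velocity in Minkowski space: \<open>J q\<close> projected off
  \<open>J p\<close> and normalised.\<close>

definition tangent :: "real^2^2" where
  "tangent = (1 / sinh (hdist p q)) *\<^sub>R (J q - mform (J p) (J q) *\<^sub>R J p)"

text \<open>The vector is the differential of \<open>hpoint\<close> at \<open>J p\<close> applied to
  \<open>tangent\<close>; \<open>hpoint\<close> reads only the first column.\<close>

lemma geo_derivative:
  "(geo p q has_vector_derivative
     Complex (Im p * tangent$1$1 - Re p * Im p * tangent$2$1) (- (Im p)\<^sup>2 * tangent$2$1))
   (at 0 within S)"
proof -
  define L where "L = hdist p q"
  have L: "sinh L > 0" using sinh_hdist_pos by (simp add: L_def)
  have pq': "mform (J p) (J q) = cosh L" using cosh_hdist[OF p q] by (simp add: L_def)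
  define A C where "A s = sinh (L - s) * (J p$1$1 / sinh L) + sinh s * (J q$1$1 / sinh L)"
    and "C s = sinh (L - s) * (J p$2$1 / sinh L) + sinh s * (J q$2$1 / sinh L)" for s
  have y: "Im p > 0" using p by (simp add: H2_def)
  have 0: "A 0 = Re p / Im p" "C 0 = 1 / Im p" using L by (simp_all add: A_def C_def)
  have "C 0 \<noteq> 0" using y by (simp add: 0)
  have interp: "((\<lambda>s. sinh (L - s) * a + sinh s * b) has_real_derivative (b - cosh L * a))
    (at 0 within S)" for a b
    by (auto intro!: derivative_eq_intros)
  have "tangent$1$1 = J q$1$1 / sinh L - cosh L * (J p$1$1 / sinh L)"
    "tangent$2$1 = J q$2$1 / sinh L - cosh L * (J p$2$1 / sinh L)"
    by (simp_all add: tangent_def pq' diff_divide_distrib flip: L_def)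
  then have dA: "(A has_real_derivative tangent$1$1) (at 0 within S)"
    and dC: "(C has_real_derivative tangent$2$1) (at 0 within S)"
    unfolding A_def C_def by (simp_all only: interp)
  have geo: "geo p q = (\<lambda>s. Complex (A s / C s) (1 / C s))"
    by (simp add: fun_eq_iff geo_def hpoint_def A_def C_def L_def mult.commute)
  have 1: "((\<lambda>s. A s / C s) has_real_derivative (Im p * tangent$1$1 - Re p * Im p * tangent$2$1))
     (at 0 within S)"
    by (rule DERIV_cong[OF DERIV_divide[OF dA dC \<open>C 0 \<noteq> 0\<close>]])
      (use y in \<open>simp add: 0 field_simps power2_eq_square\<close>)
  have 2: "((\<lambda>s. 1 / C s) has_real_derivative (- (Im p)\<^sup>2 * tangent$2$1)) (at 0 within S)"
    by (rule DERIV_cong[OF DERIV_divide[OF DERIV_const dC \<open>C 0 \<noteq> 0\<close>]])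
      (use y in \<open>simp add: 0 field_simps power2_eq_square\<close>)
  show ?thesis
    unfolding geo has_vector_derivative_complex_iff using 1 2
    by simp
qed

lemma hdir_eq:
  "hdir p q = Complex (Im p * tangent$1$1 - Re p * Im p * tangent$2$1) (- (Im p)\<^sup>2 * tangent$2$1)"
  unfolding hdir_def
proof (rule the_equality)
  show "\<exists>\<gamma>. hsegment \<gamma> p q \<and> (\<gamma> has_vector_derivative
     Complex (Im p * tangent$1$1 - Re p * Im p * tangent$2$1) (- (Im p)\<^sup>2 * tangent$2$1))
     (at 0 within {0..hdist p q})"
    using hsegment_geo geo_derivative by blast
next
  fix v assume "\<exists>\<gamma>. hsegment \<gamma> p q \<and> (\<gamma> has_vector_derivative v) (at 0 within {0..hdist p q})"
  then obtain \<gamma> where g: "hsegment \<gamma> p q"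
    and d: "(\<gamma> has_vector_derivative v) (at 0 within {0..hdist p q})" by blast
  have "(geo p q has_vector_derivative v) (at 0 within {0..hdist p q})"
    by (rule has_vector_derivative_transform[OF _ _ d])
      (use hsegment_unique[OF g] hdist_pos[OF p q pq] in auto)
  then show "v = Complex (Im p * tangent$1$1 - Re p * Im p * tangent$2$1)
      (- (Im p)\<^sup>2 * tangent$2$1)"
    using vector_derivative_unique_within_closed_interval[of 0 "hdist p q" 0 "geo p q"]
      geo_derivative hdist_pos[OF p q pq] by (simp add: cbox_interval)
qed

lemma hmidpoint_eq: "hmidpoint p q = geo p q (hdist p q / 2)"
  unfolding hmidpoint_def
proof (rule the_equality)
  have L: "hdist p q > 0" by (rule hdist_pos[OF p q pq])
  then have "hdist (geo p q 0) (geo p q (hdist p q / 2)) = hdist p q / 2"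
    "hdist (geo p q (hdist p q / 2)) (geo p q (hdist p q)) = hdist p q / 2"
    by (subst hdist_geo; simp)+
  then show "geo p q (hdist p q / 2) \<in> H2 \<and> hdist p (geo p q (hdist p q / 2)) = hdist p q / 2 \<and>
    hdist (geo p q (hdist p q / 2)) q = hdist p q / 2"
    using L geo_in_H2 by (simp add: geo_0 geo_end)
  fix m assume "m \<in> H2 \<and> hdist p m = hdist p q / 2 \<and> hdist m q = hdist p q / 2"
  then show "m = geo p q (hdist p q / 2)"
    using L by (intro geo_unique) auto
qed

lemma hmidpoint_in_H2: "hmidpoint p q \<in> H2"
  unfolding hmidpoint_eq using hdist_pos[OF p q pq] by (intro geo_in_H2) auto

lemma J_hmidpoint:
  "J (hmidpoint p q) = (1 / sqrt (2 * (1 + mform (J p) (J q)))) *\<^sub>R (J p + J q)"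
proof -
  define l where "l = hdist p q / 2"
  have L: "hdist p q = 2 * l" and l: "l > 0" using hdist_pos[OF p q pq] by (simp_all add: l_def)
  have "2 * (1 + mform (J p) (J q)) = (2 * cosh l)\<^sup>2"
    using cosh_hdist[OF p q] cosh_square_eq[of l] by (simp add: L cosh_double power_mult_distrib)
  then have "sqrt (2 * (1 + mform (J p) (J q))) = 2 * cosh l"
    by (simp only: real_sqrt_abs) simp
  moreover have "J (geo p q l) = (1 / (2 * cosh l)) *\<^sub>R (J p + J q)"
    using l by (subst J_geo) (simp_all add: L sinh_double scaleR_right_distrib)
  ultimately show ?thesis
    unfolding hmidpoint_eq by (simp add: L)
qed

end

text \<open>The square of \<open>Im p\<close> is the conformal factor between the Euclidean and the
  hyperbolic metric; the minus sign appears because the form is negative on tangent vectors.\<close>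

lemma inner_tangent:
  assumes p: "p \<in> H2" and "u$2$2 = - u$1$1" "v$2$2 = - v$1$1" "mform (J p) u = 0" "mform (J p) v = 0"
  shows "inner (Complex (Im p * u$1$1 - Re p * Im p * u$2$1) (- (Im p)\<^sup>2 * u$2$1))
               (Complex (Im p * v$1$1 - Re p * Im p * v$2$1) (- (Im p)\<^sup>2 * v$2$1))
         = - (Im p)\<^sup>2 * mform u v"
proof -
  have y: "Im p > 0" using p by (simp add: H2_def)
  have *: "w$1$2 = (((Re p)\<^sup>2 + (Im p)\<^sup>2) * w$2$1 - 2 * Re p * w$1$1)" if "mform (J p) w = 0" for w
    using that y by (simp add: mform_def field_simps)
  show ?thesis
    unfolding inner_complex_def mform_def *[OF assms(4)] *[OF assms(5)]
    by (simp add: field_simps power2_eq_square power3_eq_cube)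
qed

lemma hangle_eq:
  assumes p: "p \<in> H2" and q: "q \<in> H2" and r: "r \<in> H2" and "p \<noteq> q" "p \<noteq> r"
  shows "hangle p q r = arccos ((mform (J p) (J q) * mform (J p) (J r) - mform (J q) (J r)) /
    (sqrt ((mform (J p) (J q))\<^sup>2 - 1) * sqrt ((mform (J p) (J r))\<^sup>2 - 1)))"
proof -
  define u where "u = tangent p q"
  define v where "v = tangent p r"
  have y: "Im p > 0" using p by (simp add: H2_def)
  have sq: "sinh (hdist p w) = sqrt ((mform (J p) (J w))\<^sup>2 - 1)" if "w \<in> H2" for w
    using p that by (simp add: hdist_eq sinh_arcosh_real mform_J_ge_1)
  have sq_pos: "sqrt ((mform (J p) (J w))\<^sup>2 - 1) > 0" if "w \<in> H2" "p \<noteq> w" for w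
    using mform_J_gt_1[OF p that] by (simp add: one_less_power)
  have tr: "u$2$2 = - u$1$1" "v$2$2 = - v$1$1"
    by (simp_all add: u_def v_def tangent_def[OF p q assms(4)] tangent_def[OF p r assms(5)]
        J_trace algebra_simps del: half_turn_matrix_nth)
  have orth: "mform (J p) u = 0" "mform (J p) v = 0"
    by (simp_all add: u_def v_def tangent_def[OF p q assms(4)] tangent_def[OF p r assms(5)]
        mform_linear mform_J_self p)
  have unit: "mform (tangent p w) (tangent p w) = -1" if "w \<in> H2" "p \<noteq> w" for w
    using sq_pos[OF that] real_sqrt_pow2[of "(mform (J p) (J w))\<^sup>2 - 1"]
    unfolding tangent_def[OF p that] mform_linear mform_J_self[OF p] mform_J_self[OF that(1)]
      mform_commute[of "J w" "J p"] sq[OF that(1)]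
    by (simp add: field_simps power2_eq_square)
  have uv: "mform u v = (mform (J q) (J r) - mform (J p) (J q) * mform (J p) (J r)) /
    (sqrt ((mform (J p) (J q))\<^sup>2 - 1) * sqrt ((mform (J p) (J r))\<^sup>2 - 1))"
    unfolding u_def v_def tangent_def[OF p q assms(4)] tangent_def[OF p r assms(5)] sq[OF q] sq[OF r]
    by (simp add: mform_linear mform_J_self p mform_commute[of "J q" "J p"] mult.commute)
  have norm: "norm (hdir p q) = Im p" "norm (hdir p r) = Im p"
    unfolding norm_eq_sqrt_inner hdir_eq[OF p q assms(4)] hdir_eq[OF p r assms(5)]
      u_def[symmetric] v_def[symmetric]
    using inner_tangent[OF p tr(1) tr(1) orth(1) orth(1)] inner_tangent[OF p tr(2) tr(2) orth(2) orth(2)]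
      unit[OF q assms(4)] unit[OF r assms(5)] y by (simp_all add: u_def v_def)
  have inn: "inner (hdir p q) (hdir p r) = - (Im p)\<^sup>2 * mform u v"
    unfolding hdir_eq[OF p q assms(4)] hdir_eq[OF p r assms(5)] u_def[symmetric] v_def[symmetric]
    by (rule inner_tangent[OF p tr orth])
  have "inner (hdir p q) (hdir p r) / (norm (hdir p q) * norm (hdir p r)) = - mform u v"
    unfolding inn norm using y by (simp add: power2_eq_square)
  also have "\<dots> = (mform (J p) (J q) * mform (J p) (J r) - mform (J q) (J r)) /
    (sqrt ((mform (J p) (J q))\<^sup>2 - 1) * sqrt ((mform (J p) (J r))\<^sup>2 - 1))"
    unfolding uv by (simp add: minus_divide_left)
  finally show ?thesis
    unfolding hangle_def by simp
qed

section \<open>Words and the geometric representation\<close>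

lemma reduced_word_exists: "\<exists>v. distinct_adj v \<and> weq u v"
proof (induction u)
  case Nil
  then show ?case using distinct_adj_Nil weq.refl by blast
next
  case (Cons x u)
  then obtain v where v: "distinct_adj v" "weq u v" by blast
  have xv: "weq (x # u) (x # v)" using weq_append1[OF v(2), of "[x]"] by simp
  show ?case
  proof (cases "v = [] \<or> hd v \<noteq> x")
    case True
    then have "distinct_adj (x # v)" using v(1) by (auto simp: distinct_adj_Cons)
    then show ?thesis using xv by blast
  next
    case False
    then obtain v' where v': "v = x # v'" by (cases v) auto
    have "weq (x # v) v'" using weq.cancel[of "[]" x v'] by (simp add: v')
    moreover have "distinct_adj v'" using v(1) by (auto simp: v' dest: distinct_adj_ConsD)
    ultimately show ?thesis using xv weq.trans by blast
  qed
qed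

lemma countable_reduced_words: "countable {w :: gen list. distinct_adj w \<and> w \<noteq> []}"
proof -
  have "finite (UNIV :: gen set)"
    by (rule finite_subset[of _ "{GP, GQ, GR}"]) (use gen.exhaust in auto)
  then have "countable (UNIV :: gen list set)"
    using countable_lists[OF countable_finite] by (metis lists_UNIV)
  then show ?thesis
    by (rule countable_subset[rotated]) simp
qed

text \<open>Conjugation by a side involution fixes its axis and negates the orthogonal complement.
  \<open>turn\<close> gives its matrix in the basis \<open>B + C\<close>, \<open>C + A\<close>, \<open>A + B\<close> of side midpoints; there all
  off-diagonal entries in a row agree, and \<open>\<kappa>\<close> collects them. This is the geometric
  representation of a Coxeter group up to sign.\<close>

definition turn :: "(gen \<Rightarrow> 'a::comm_ring_1) \<Rightarrow> gen \<Rightarrow> (gen \<Rightarrow> 'a) \<Rightarrow> gen \<Rightarrow> 'a" where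
  "turn \<kappa> x v = (\<lambda>y. if y = x then v x + \<kappa> x * (v GP + v GQ + v GR - v x) else - v y)"

text \<open>Only the orbit of (1, 1, 1) is followed, not the whole matrix: a word that moves this
  vector cannot be trivial.\<close>

definition act :: "(gen \<Rightarrow> 'a::comm_ring_1) \<Rightarrow> gen list \<Rightarrow> gen \<Rightarrow> 'a" where
  "act \<kappa> w = foldr (turn \<kappa>) w (\<lambda>_. 1)"

lemma act_Nil: "act \<kappa> [] = (\<lambda>_. 1)" and act_Cons: "act \<kappa> (x # w) = turn \<kappa> x (act \<kappa> w)"
  by (simp_all add: act_def)

text \<open>The entries arise by ring operations from the parameters, so one definition serves
  reals, polynomials to be evaluated, and complex extensions.\<close>

lemma act_ring_hom:
  assumes "\<And>a b. h (a + b) = h a + h b" "\<And>a b. h (a * b) = h a * h b" "h 1 = 1"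
    "\<And>a. h (- a) = - h a"
  shows "h (act \<kappa> w y) = act (\<lambda>x. h (\<kappa> x)) w y"
proof (induction w arbitrary: y)
  case (Cons x w)
  have "h (a - b) = h a - h b" for a b using assms(1)[of a "- b"] assms(4)[of b] by simp
  then show ?case using Cons assms by (simp add: act_Cons turn_def)
qed (simp add: act_Nil assms)

text \<open>Equilateral triangles have parameters in \<open>{2<..<3}\<close>, but the entries are polynomials in the
  parameter, so it suffices to be nontrivial at one value. At \<open>-2\<close> all coordinates of the orbit of
  \<open>(1, 1, 1)\<close> have the same sign and ping-pong applies.\<close>

lemma act_minus2_growth:
  assumes "distinct_adj w" "w \<noteq> []"
  defines "v \<equiv> act (\<lambda>_. -2 :: real) w"
  shows "\<exists>\<sigma>\<in>{1, -1}. \<sigma> * v (hd w) \<ge> 3 \<and>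
    (\<forall>y. \<sigma> * v y > 0 \<and> (y \<noteq> hd w \<longrightarrow> \<sigma> * v y < \<sigma> * v (hd w)))"
  using assms(1,2) unfolding v_def
proof (induction w)
  case (Cons x w)
  show ?case
  proof (cases "w = []")
    case True
    \<comment> \<open>A single letter turns (1, 1, 1) into 1 + (-2) * 2 = -3 at its own place and -1
      elsewhere; hence the bound 3.\<close>
    then show ?thesis by (intro bexI[of _ "-1"]) (auto simp: act_Cons act_Nil turn_def)
  next
    case False
    define u where "u = act (\<lambda>_. -2 :: real) w"
    have "distinct_adj w" using Cons.prems by (auto simp: distinct_adj_Cons)
    from Cons.IH[OF this False] obtain \<sigma> where \<sigma>: "\<sigma> \<in> {1, -1}" and *: "\<sigma> * u (hd w) \<ge> 3 \<and>
        (\<forall>y. \<sigma> * u y > 0 \<and> (y \<noteq> hd w \<longrightarrow> \<sigma> * u y < \<sigma> * u (hd w)))"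
      unfolding u_def by blast
    define U where "U y = \<sigma> * u y" for y
    have big: "U (hd w) \<ge> 3" and pos: "U y > 0" and less: "y \<noteq> hd w \<Longrightarrow> U y < U (hd w)" for y
      using * unfolding U_def by blast+
    have xh: "x \<noteq> hd w" using Cons.prems False by (simp add: distinct_adj_Cons)
    define V where "V = (\<lambda>y. - \<sigma> * act (\<lambda>_. -2) (x # w) y)"
    have Vx: "V x = 2 * (U GP + U GQ + U GR - U x) - U x"
      by (simp add: V_def act_Cons turn_def U_def algebra_simps flip: u_def)
    have Vy: "V y = U y" if "y \<noteq> x" for y
      using that by (simp add: V_def act_Cons turn_def U_def flip: u_def)
    \<comment> \<open>With z the letter besides \<open>x\<close> and \<open>hd w\<close>,
      \<open>V x\<close> is 2 (U (hd w) + U z) - U x, which exceeds U (hd w) + 2 U z because U x < U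
      (hd w).\<close>
    have lt: "V y < V x" if "y \<noteq> x" for y
      unfolding Vx Vy[OF that] using pos[of GP] pos[of GQ] pos[of GR] less[OF xh] less[of y] xh that
      by (cases x; cases y; cases "hd w") simp_all
    show ?thesis
    proof (intro bexI[of _ "- \<sigma>"] conjI allI impI)
      show "- \<sigma> \<in> {1, -1}" using \<sigma> by auto
      have "3 \<le> V x" using lt[of "hd w"] Vy[of "hd w"] xh big by auto
      then show "3 \<le> - \<sigma> * act (\<lambda>_. -2) (x # w) (hd (x # w))"
        by (simp add: V_def)
      fix y
      have "0 < V y"
        using \<open>3 \<le> V x\<close> Vy[of y] pos[of y] by (cases "y = x") auto
      then show "0 < - \<sigma> * act (\<lambda>_. -2) (x # w) y"
        by (simp only: V_def)
      show "- \<sigma> * act (\<lambda>_. -2) (x # w) y < - \<sigma> * act (\<lambda>_. -2) (x # w) (hd (x # w))"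
        if "y \<noteq> hd (x # w)"
        using lt[of y] that by (simp add: V_def)
    qed
  qed
qed simp

lemma act_minus2_nontrivial:
  assumes "distinct_adj w" "w \<noteq> []"
  shows "act (\<lambda>_. -2 :: real) w \<noteq> (\<lambda>_. 1)"
  using act_minus2_growth[OF assms] by auto

lemma finite_act_trivial:
  assumes "distinct_adj w" "w \<noteq> []"
  shows "finite {\<xi> :: real. act (\<lambda>_. \<xi>) w = (\<lambda>_. 1)}"
proof -
  obtain y where y: "act (\<lambda>_. -2 :: real) w y \<noteq> 1"
    using act_minus2_nontrivial[OF assms] by auto
  define F :: "real poly" where "F = act (\<lambda>_. [:0, 1:]) w y - 1"
  have F: "poly F \<xi> = act (\<lambda>_. \<xi>) w y - 1" for \<xi>
    by (simp add: F_def act_ring_hom[where h = "\<lambda>p. poly p \<xi>"])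
  then have "F \<noteq> 0" using y by (metis eq_iff_diff_eq_0 poly_0)
  then have "finite {\<xi>. poly F \<xi> = 0}" by (rule poly_roots_finite)
  then show ?thesis by (rule rev_finite_subset) (auto simp: F)
qed

lemma turn_turn: "turn \<kappa> x (turn \<kappa> x v) = v"
  by (cases x) (auto simp: turn_def fun_eq_iff algebra_simps)

lemma foldr_turn_weq: "weq u v \<Longrightarrow> foldr (turn \<kappa>) u = foldr (turn \<kappa>) v"
proof (induction rule: weq.induct)
  case (cancel u x v)
  show ?case by (simp add: fun_eq_iff turn_turn)
qed auto

text \<open>The action at -2 respects \<open>weq\<close> and is nontrivial for every nonempty
  reduced word, so it solves the word problem in \<open>W\<close> without a confluence
  argument.\<close>

lemma reduced_not_weq_Nil:
  assumes "distinct_adj w" "w \<noteq> []"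
  shows "\<not> weq w []"
proof
  assume "weq w []"
  from foldr_turn_weq[OF this, of "\<lambda>_. -2 :: real"] act_minus2_nontrivial[OF assms] show False
    by (simp add: act_def fun_eq_iff)
qed

section \<open>Words in PSL(2,R) and their matrix representatives\<close>

definition mword :: "(gen \<Rightarrow> real^2^2) \<Rightarrow> gen list \<Rightarrow> real^2^2" where
  "mword H w = foldr (\<lambda>x g. H x ** g) w (mat 1)"

lemma mword_append: "mword H (u @ v) = mword H u ** mword H v"
  by (induction u) (simp_all add: mword_def matrix_mul_assoc)

lemma mult_PSL2R:
  assumes "det g = 1" "det h = 1"
  shows "{g, - g} \<otimes>\<^bsub>PSL2R\<^esub> {h, - h} = {g ** h, - (g ** h)}"
proof -
  have "g \<in> carrier SL2R" "h \<in> carrier SL2R" using assms by (simp_all add: SL2R_def)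
  from normal.rcos_sum[OF normal_center this]
  have "({mat 1, - mat 1} #>\<^bsub>SL2R\<^esub> g) \<otimes>\<^bsub>PSL2R\<^esub> ({mat 1, - mat 1} #>\<^bsub>SL2R\<^esub> h) =
      {mat 1, - mat 1} #>\<^bsub>SL2R\<^esub> (g \<otimes>\<^bsub>SL2R\<^esub> h)"
    by (simp add: PSL2R_def FactGroup_def)
  then show ?thesis
    unfolding SL2R_rcoset by (simp add: SL2R_def)
qed

lemma word_value_mword:
  assumes "\<And>x. det (H x) = 1" "\<And>x. f x = {H x, - H x}"
  shows "word_value f w = {mword H w, - mword H w}" "det (mword H w) = 1"
proof (induction w)
  case Nil
  {
    case 1 then show ?case by (simp add: word_value_def mword_def one_PSL2R)
  next
    case 2 then show ?case by (simp add: mword_def)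
  }
next
  case (Cons x w)
  {
    case 1
    then show ?case
      using Cons assms mult_PSL2R[OF assms(1)[of x] Cons(2)]
      by (simp add: word_value_def mword_def)
  next
    case 2
    then show ?case using Cons assms by (simp add: mword_def det_mul)
  }
qed

lemma word_value_one_iff:
  assumes "\<And>x. det (H x) = 1" "\<And>x. f x = {H x, - H x}"
  shows "word_value f w = \<one>\<^bsub>PSL2R\<^esub> \<longleftrightarrow> mword H w = mat 1 \<or> mword H w = - mat 1"
  unfolding word_value_mword[OF assms] one_PSL2R by (auto simp: doubleton_eq_iff)

section \<open>Trigonometry of a triangle\<close>

text \<open>On traceless matrices \<open>tdet\<close> is the volume form of the Minkowski space.\<close>

definition tdet :: "real^2^2 \<Rightarrow> real^2^2 \<Rightarrow> real^2^2 \<Rightarrow> real" where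
  "tdet L M N = trace (L ** M ** N) / 2"

lemma trace_2: "trace (M :: real^2^2) = M$1$1 + M$2$2"
  by (simp add: trace_def sum_2)

lemma tdet_rotate: "tdet L M N = tdet M N L"
  unfolding tdet_def by (metis matrix_mul_assoc trace_mul_sym)

lemma anticommutator:
  assumes "M$2$2 = - M$1$1" "N$2$2 = - N$1$1"
  shows "M ** N + N ** M = (- 2 * mform M N) *\<^sub>R mat 1"
  unfolding mat2_eq_iff using assms
  by (simp add: matrix_mult_nth mat_nth mform_def field_simps)

lemma matrix_mult_scaleR:
  fixes M N :: "real^2^2"
  shows "(r *\<^sub>R M) ** N = r *\<^sub>R (M ** N)" "M ** (r *\<^sub>R N) = r *\<^sub>R (M ** N)"
  by (simp_all add: mat2_eq_iff matrix_mult_nth algebra_simps)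

text \<open>As \<open>H ** M + M ** H\<close> is scalar, conjugation by \<open>H\<close> is a
  half-turn of Minkowski space. Stated as an exchange of factors it avoids inverses and lets a
  vector pass through a word letter by letter.\<close>

lemma half_turn_conj:
  assumes "H$2$2 = - H$1$1" "M$2$2 = - M$1$1" "H ** H = - mat 1"
  shows "H ** M = ((2 * mform H M) *\<^sub>R H - M) ** H"
proof -
  have "H ** M = (- 2 * mform H M) *\<^sub>R mat 1 - M ** H"
    using anticommutator[OF assms(1,2)] by (metis add_diff_cancel_right')
  moreover have "((2 * mform H M) *\<^sub>R H - M) ** H = (2 * mform H M) *\<^sub>R (H ** H) - M ** H"
    by (simp add: mat2_eq_iff matrix_mult_nth algebra_simps)
  ultimately show ?thesis by (simp add: assms(3))
qed

text \<open>The right side is the Gram determinant of the three vectors.\<close>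

lemma gram_det:
  assumes "L$2$2 = - L$1$1" "M$2$2 = - M$1$1" "N$2$2 = - N$1$1"
  shows "(tdet L M N)\<^sup>2 = mform L L * mform M M * mform N N
    + 2 * mform L M * mform M N * mform N L
    - mform L L * (mform M N)\<^sup>2 - mform M M * (mform N L)\<^sup>2 - mform N N * (mform L M)\<^sup>2"
  unfolding tdet_def trace_2 matrix_mult_nth mform_def assms
  by (simp add: field_simps power2_eq_square)

lemma gram_det_J:
  assumes "A \<in> H2" "B \<in> H2" "C \<in> H2"
  shows "(tdet (J C) (J B) (J A))\<^sup>2 = 1
    + 2 * mform (J B) (J C) * mform (J C) (J A) * mform (J A) (J B)
    - (mform (J B) (J C))\<^sup>2 - (mform (J C) (J A))\<^sup>2 - (mform (J A) (J B))\<^sup>2"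
  using gram_det[OF J_trace J_trace J_trace, of C B A] mform_J_self[OF assms(1)]
    mform_J_self[OF assms(2)] mform_J_self[OF assms(3)]
  by (simp add: mform_commute[of "J C" "J B"] mform_commute[of "J B" "J A"]
      mform_commute[of "J A" "J C"] algebra_simps)

text \<open>With x, y, z the three products, the Gram determinant is s^2 - (x y - z)^2: it bounds
  the argument of arccos and also supplies the sine. The factor \<open>s\<close> keeps later
  identities polynomial.\<close>

lemma hangle_cos_sin:
  assumes p: "p \<in> H2" and q: "q \<in> H2" and r: "r \<in> H2" and "p \<noteq> q" "p \<noteq> r"
    and a: "hangle p q r = a"
  defines "s \<equiv> sqrt ((mform (J p) (J q))\<^sup>2 - 1) * sqrt ((mform (J p) (J r))\<^sup>2 - 1)"
  shows "cos a * s = mform (J p) (J q) * mform (J p) (J r) - mform (J q) (J r)"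
    and "sin a * s = \<bar>tdet (J r) (J q) (J p)\<bar>"
proof -
  define x y z where xyz: "x = mform (J p) (J q)" "y = mform (J p) (J r)" "z = mform (J q) (J r)"
  have x: "x\<^sup>2 - 1 > 0" using mform_J_gt_1[OF p q assms(4)] by (simp add: xyz one_less_power)
  have y: "y\<^sup>2 - 1 > 0" using mform_J_gt_1[OF p r assms(5)] by (simp add: xyz one_less_power)
  have s: "s > 0" "s\<^sup>2 = (x\<^sup>2 - 1) * (y\<^sup>2 - 1)"
    using x y by (simp_all add: s_def xyz power_mult_distrib)
  have gram: "(tdet (J r) (J q) (J p))\<^sup>2 = s\<^sup>2 - (x * y - z)\<^sup>2"
    unfolding gram_det_J[OF p q r] s(2) mform_commute[of "J r" "J p"] xyz[symmetric]
    by (simp add: algebra_simps power2_eq_square)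
  then have "(x * y - z)\<^sup>2 \<le> s\<^sup>2" using zero_le_power2[of "tdet (J r) (J q) (J p)"] by linarith
  then have le: "\<bar>x * y - z\<bar> \<le> s" using s(1) by (simp add: abs_le_square_iff[symmetric])
  have t: "a = arccos ((x * y - z) / s)"
    using hangle_eq[OF p q r assms(4,5)] a by (simp add: s_def xyz)
  have bd: "- 1 \<le> (x * y - z) / s" "(x * y - z) / s \<le> 1"
    using le s(1) by (simp_all add: abs_le_iff field_simps)
  have cos: "cos a = (x * y - z) / s"
    unfolding t using bd by (simp add: cos_arccos)
  then show "cos a * s = mform (J p) (J q) * mform (J p) (J r) - mform (J q) (J r)"
    using s(1) by (simp add: xyz)
  have "0 \<le> a" "a \<le> pi"
    unfolding t using bd by (simp_all add: arccos_lbound arccos_ubound)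
  then have sin0: "sin a \<ge> 0" by (rule sin_ge_zero)
  have "(sin a * s)\<^sup>2 = s\<^sup>2 - (cos a * s)\<^sup>2"
    by (simp add: power_mult_distrib sin_squared_eq algebra_simps)
  also have "\<dots> = (tdet (J r) (J q) (J p))\<^sup>2"
    unfolding gram using cos s(1) by simp
  finally show "sin a * s = \<bar>tdet (J r) (J q) (J p)\<bar>"
    using sin0 s(1) by (metis abs_of_nonneg mult_nonneg_nonneg order_less_imp_le real_sqrt_abs)
qed

text \<open>For \<open>a\<close>, \<open>b\<close>, \<open>c\<close> the cosh of the sides,
  \<open>G\<close> is the Gram determinant. The first identity evaluates the cosine of the angle sum
  after clearing denominators; the second makes \<open>(S, \<delta>)\<close> a vector of length
  \<open>D\<close>, whose argument is half the area up to sign.\<close>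

lemma angle_sum_identity:
  fixes a b c :: real
  assumes "G = 1 + 2 * a * b * c - a\<^sup>2 - b\<^sup>2 - c\<^sup>2"
  shows "2 * ((b * c - a) * (c * a - b) * (a * b - c)
      - G * ((b * c - a) + (c * a - b) + (a * b - c)))
    = - ((1 + a + b + c)\<^sup>2 - G) * ((a - 1) * (b - 1) * (c - 1))"
    and "(1 + a + b + c)\<^sup>2 + G = 2 * ((1 + a) * (1 + b) * (1 + c))"
  using assms by Groebner_Basis.algebra+

lemma has_angles_rotate:
  "has_angles (A, B, C) (a, b, c) \<Longrightarrow> has_angles (B, C, A) (b, c, a)"
  by (auto simp: has_angles_def)

locale hyperbolic_triangle =
  fixes A B C :: complex and \<alpha> \<beta> \<gamma> \<phi> :: real
  assumes angles: "has_angles (A, B, C) (\<alpha>, \<beta>, \<gamma>)"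
    and \<phi>: "0 < \<phi>" "\<phi> < pi"
    and sum: "(\<alpha>, \<beta>, \<gamma>) \<in> triangle_angles \<phi>"
begin

lemma H2: "A \<in> H2" "B \<in> H2" "C \<in> H2"
  and distinct: "A \<noteq> B" "B \<noteq> C" "C \<noteq> A"
  and hangles: "hangle A B C = \<alpha>" "hangle B C A = \<beta>" "hangle C A B = \<gamma>"
  using angles by (simp_all add: has_angles_def)

lemma angle_bounds: "0 < \<alpha>" "\<alpha> < pi" "0 < \<beta>" "\<beta> < pi" "0 < \<gamma>" "\<gamma> < pi"
  and angle_sum: "\<alpha> + \<beta> + \<gamma> = pi - \<phi>"
  using sum by (simp_all add: triangle_angles_def)

definition "ha = mform (J B) (J C)"
definition "hb = mform (J C) (J A)"
definition "hc = mform (J A) (J B)"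
definition "S = 1 + ha + hb + hc"
definition "D = sqrt (2 * ((1 + ha) * (1 + hb) * (1 + hc)))"
definition "\<delta> = tdet (J C) (J B) (J A)"

lemma h_gt_1: "ha > 1" "hb > 1" "hc > 1"
  using mform_J_gt_1 H2 distinct by (simp_all add: ha_def hb_def hc_def)

lemma S_pos: "S > 0" using h_gt_1 by (simp add: S_def)

lemma D2: "D\<^sup>2 = 2 * ((1 + ha) * (1 + hb) * (1 + hc))" and D_pos: "D > 0"
  using h_gt_1 by (simp_all add: D_def)

lemma delta2: "\<delta>\<^sup>2 = 1 + 2 * ha * hb * hc - ha\<^sup>2 - hb\<^sup>2 - hc\<^sup>2"
  unfolding \<delta>_def ha_def hb_def hc_def by (rule gram_det_J[OF H2])

definition "sa = sqrt (ha\<^sup>2 - 1)"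
definition "sb = sqrt (hb\<^sup>2 - 1)"
definition "sc = sqrt (hc\<^sup>2 - 1)"

lemma s_pos: "sa > 0" "sb > 0" "sc > 0"
  and s2: "sa\<^sup>2 = ha\<^sup>2 - 1" "sb\<^sup>2 = hb\<^sup>2 - 1" "sc\<^sup>2 = hc\<^sup>2 - 1"
  using h_gt_1 one_less_power[of _ 2] by (simp_all add: sa_def sb_def sc_def less_imp_le)

lemma cos_angles: "cos \<alpha> * (sc * sb) = hb * hc - ha" "cos \<beta> * (sa * sc) = hc * ha - hb"
    "cos \<gamma> * (sb * sa) = ha * hb - hc"
  and sin_angles: "sin \<alpha> * (sc * sb) = \<bar>\<delta>\<bar>" "sin \<beta> * (sa * sc) = \<bar>\<delta>\<bar>" "sin \<gamma> * (sb * sa) = \<bar>\<delta>\<bar>"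
proof -
  have eq: "mform (J A) (J B) = hc" "mform (J B) (J A) = hc" "mform (J B) (J C) = ha"
    "mform (J C) (J B) = ha" "mform (J A) (J C) = hb" "mform (J C) (J A) = hb"
    by (simp_all add: ha_def hb_def hc_def mform_commute)
  have d: "tdet (J C) (J B) (J A) = \<delta>" "tdet (J A) (J C) (J B) = \<delta>" "tdet (J B) (J A) (J C) = \<delta>"
    unfolding \<delta>_def using tdet_rotate by metis+
  note 1 = hangle_cos_sin[OF H2(1,2,3) distinct(1) distinct(3)[symmetric] hangles(1), unfolded eq d]
  note 2 = hangle_cos_sin[OF H2(2,3,1) distinct(2) distinct(1)[symmetric] hangles(2), unfolded eq d]
  note 3 = hangle_cos_sin[OF H2(3,1,2) distinct(3) distinct(2)[symmetric] hangles(3), unfolded eq d]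
  show "cos \<alpha> * (sc * sb) = hb * hc - ha" "cos \<beta> * (sa * sc) = hc * ha - hb"
    "cos \<gamma> * (sb * sa) = ha * hb - hc" "sin \<alpha> * (sc * sb) = \<bar>\<delta>\<bar>" "sin \<beta> * (sa * sc) = \<bar>\<delta>\<bar>"
    "sin \<gamma> * (sb * sa) = \<bar>\<delta>\<bar>"
    using 1 2 3 by (simp_all add: sa_def sb_def sc_def mult.commute)
qed

lemma delta_nonzero: "\<delta> \<noteq> 0"
proof -
  have "sin \<alpha> * (sc * sb) > 0" using sin_gt_zero[OF angle_bounds(1,2)] s_pos by simp
  then show ?thesis unfolding sin_angles by simp
qed

lemma S2_delta2: "S\<^sup>2 + \<delta>\<^sup>2 = D\<^sup>2"
  unfolding D2 S_def using angle_sum_identity(2)[OF delta2] .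

lemma cos_area: "cos \<phi> * D\<^sup>2 = S\<^sup>2 - \<delta>\<^sup>2"
proof -
  define P where "P = (sa * sb * sc)\<^sup>2"
  have P: "P = (ha - 1) * (hb - 1) * (hc - 1) * ((1 + ha) * (1 + hb) * (1 + hc))"
    unfolding P_def power_mult_distrib s2 by Groebner_Basis.algebra
  have nz: "(ha - 1) * (hb - 1) * (hc - 1) \<noteq> 0" using h_gt_1 by simp
  have "cos \<phi> = - cos (\<alpha> + \<beta> + \<gamma>)" by (simp add: angle_sum)
  also have "\<dots> = - (cos \<alpha> * cos \<beta> * cos \<gamma> - cos \<alpha> * (sin \<beta> * sin \<gamma>)
      - cos \<beta> * (sin \<alpha> * sin \<gamma>) - cos \<gamma> * (sin \<alpha> * sin \<beta>))"
    by (simp add: cos_add sin_add algebra_simps)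
  \<comment> \<open>The factors \<open>sc * sb\<close>, \<open>sa * sc\<close> and
    \<open>sb * sa\<close> multiply to \<open>P\<close>, so every cosine and sine becomes an
    expression in the sides.\<close>
  finally have "cos \<phi> * P = - ((cos \<alpha> * (sc * sb)) * (cos \<beta> * (sa * sc)) * (cos \<gamma> * (sb * sa))
      - (cos \<alpha> * (sc * sb)) * ((sin \<beta> * (sa * sc)) * (sin \<gamma> * (sb * sa)))
      - (cos \<beta> * (sa * sc)) * ((sin \<alpha> * (sc * sb)) * (sin \<gamma> * (sb * sa)))
      - (cos \<gamma> * (sb * sa)) * ((sin \<alpha> * (sc * sb)) * (sin \<beta> * (sa * sc))))"
    unfolding P_def by Groebner_Basis.algebra
  also have "\<dots> = - ((hb * hc - ha) * (hc * ha - hb) * (ha * hb - hc)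
      - \<delta>\<^sup>2 * ((hb * hc - ha) + (hc * ha - hb) + (ha * hb - hc)))"
    unfolding cos_angles sin_angles by (simp add: algebra_simps power2_eq_square)
  finally have "2 * (cos \<phi> * P) = (S\<^sup>2 - \<delta>\<^sup>2) * ((ha - 1) * (hb - 1) * (hc - 1))"
    using angle_sum_identity(1)[OF delta2] unfolding S_def by Groebner_Basis.algebra
  then have "((ha - 1) * (hb - 1) * (hc - 1)) * (cos \<phi> * D\<^sup>2)
      = ((ha - 1) * (hb - 1) * (hc - 1)) * (S\<^sup>2 - \<delta>\<^sup>2)"
    unfolding P D2 by (simp add: algebra_simps)
  then show ?thesis using nz by simp
qed

lemma half_area: "cos (\<phi> / 2) = S / D" "sin (\<phi> / 2) = \<bar>\<delta>\<bar> / D"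
proof -
  have c: "cos \<phi> = 2 * (cos (\<phi> / 2))\<^sup>2 - 1" "cos \<phi> = 1 - 2 * (sin (\<phi> / 2))\<^sup>2"
    using cos_double_cos[of "\<phi> / 2"] cos_double_sin[of "\<phi> / 2"] by simp_all
  have "(cos (\<phi> / 2) * D)\<^sup>2 = S\<^sup>2" "(sin (\<phi> / 2) * D)\<^sup>2 = \<bar>\<delta>\<bar>\<^sup>2"
    using cos_area c S2_delta2 unfolding power_mult_distrib power2_abs by Groebner_Basis.algebra+
  moreover have "cos (\<phi> / 2) > 0" "sin (\<phi> / 2) > 0"
    using \<phi> by (simp_all add: cos_gt_zero sin_gt_zero)
  ultimately have "cos (\<phi> / 2) * D = S" "sin (\<phi> / 2) * D = \<bar>\<delta>\<bar>"
    using S_pos D_pos power2_eq_imp_eq[of _ "\<bar>\<delta>\<bar>"] by (simp_all add: power2_eq_iff_nonneg)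
  then show "cos (\<phi> / 2) = S / D" "sin (\<phi> / 2) = \<bar>\<delta>\<bar> / D"
    using D_pos by (simp_all add: field_simps)
qed

lemma sin_area: "sin \<phi> * D\<^sup>2 = 2 * S * \<bar>\<delta>\<bar>"
  using sin_double[of "\<phi> / 2"] D_pos by (simp add: half_area power2_eq_square)

end

text \<open>The parameter \<open>S / (1 + ha)\<close> of a half-turn in terms of the area and the
  opposite angle: analytic in the angle and independent of the triangle that realises it.\<close>

definition kappa :: "real \<Rightarrow> real \<Rightarrow> real" where
  "kappa \<phi> a = 1 + cos \<phi> + sin \<phi> * (cos a / sin a)"

context hyperbolic_triangle
begin

lemma kappa_alpha: "S / (1 + ha) = kappa \<phi> \<alpha>"
proof -
  have 1: "1 + cos \<phi> = 2 * S\<^sup>2 / D\<^sup>2" and 2: "sin \<phi> = 2 * S * \<bar>\<delta>\<bar> / D\<^sup>2"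
    using cos_area sin_area S2_delta2 D_pos by (simp_all add: field_simps)
  have "cos \<alpha> / sin \<alpha> = (cos \<alpha> * (sc * sb)) / (sin \<alpha> * (sc * sb))"
    using s_pos by simp
  also have "\<dots> = (hb * hc - ha) / \<bar>\<delta>\<bar>" unfolding cos_angles sin_angles ..
  finally have "kappa \<phi> \<alpha> = 2 * S\<^sup>2 / D\<^sup>2 + 2 * S * (hb * hc - ha) / D\<^sup>2"
    unfolding kappa_def 1 2 using delta_nonzero by simp
  also have "\<dots> = 2 * S * (S + hb * hc - ha) / D\<^sup>2"
    by (simp add: add_divide_distrib[symmetric] algebra_simps power2_eq_square)
  also have "S + hb * hc - ha = (1 + hb) * (1 + hc)" by (simp add: S_def algebra_simps)
  also have "2 * S * ((1 + hb) * (1 + hc)) / D\<^sup>2 = S / (1 + ha)"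
  proof -
    have "(1 + hb) * (1 + hc) \<noteq> 0" "1 + ha \<noteq> 0" using h_gt_1 by auto
    then show ?thesis unfolding D2 by (simp add: frac_eq_eq)
  qed
  finally show ?thesis by simp
qed

text \<open>Cyclic relabelling carries facts about the vertex \<open>A\<close> over to
  \<open>B\<close> and \<open>C\<close>.\<close>

lemma rotated: "hyperbolic_triangle B C A \<beta> \<gamma> \<alpha> \<phi>"
  using has_angles_rotate[OF angles] \<phi> sum
  by unfold_locales (auto simp: triangle_angles_def)

end

context hyperbolic_triangle
begin

interpretation bca: hyperbolic_triangle B C A \<beta> \<gamma> \<alpha> \<phi> by (rule rotated)
interpretation cab: hyperbolic_triangle C A B \<gamma> \<alpha> \<beta> \<phi> by (rule bca.rotated)

lemma rotated_quantities:
  "bca.ha = hb" "bca.hb = hc" "bca.hc = ha" "cab.ha = hc" "cab.hb = ha" "cab.hc = hb"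
  "bca.S = S" "cab.S = S" "bca.D = D" "cab.D = D" "bca.\<delta> = \<delta>" "cab.\<delta> = \<delta>"
proof -
  show h: "bca.ha = hb" "bca.hb = hc" "bca.hc = ha" "cab.ha = hc" "cab.hb = ha" "cab.hc = hb"
    by (simp_all add: ha_def hb_def hc_def bca.ha_def bca.hb_def bca.hc_def
        cab.ha_def cab.hb_def cab.hc_def)
  show "bca.S = S" "cab.S = S" "bca.D = D" "cab.D = D"
    by (simp_all add: S_def bca.S_def cab.S_def D_def bca.D_def cab.D_def h mult_ac add_ac)
  show "bca.\<delta> = \<delta>" "cab.\<delta> = \<delta>"
    unfolding \<delta>_def bca.\<delta>_def cab.\<delta>_def using tdet_rotate by metis+
qed

lemmas kappa_eqs = kappa_alpha bca.kappa_alpha[unfolded rotated_quantities]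
  cab.kappa_alpha[unfolded rotated_quantities]

end

text \<open>By the second law of cosines, this quotient is the hyperbolic cosine of the side opposite
  to \<open>a\<close>.\<close>

lemma law_of_cosines_gt_1:
  assumes "0 < a" "0 < b" "0 < c" "a + b + c < pi"
  shows "(cos a + cos b * cos c) / (sin b * sin c) > 1"
proof -
  have "sin b * sin c > 0" using assms by (simp add: sin_gt_zero)
  moreover have "cos (pi - (b + c)) < cos a"
    by (rule cos_monotone_0_pi) (use assms in auto)
  then have "cos a + cos b * cos c > sin b * sin c" by (simp add: cos_add)
  ultimately show ?thesis by (simp add: less_divide_eq)
qed

text \<open>The sides come from the second law of cosines. \<open>A\<close> is the point i,
  \<open>B\<close> lies in the direction \<open>u\<close>, and \<open>C\<close> in the direction at
  angle \<open>a\<close> from \<open>u\<close>; the third side and all angles are then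
  verified.\<close>

lemma triangle_exists:
  assumes "0 < a" "0 < b" "0 < c" "a + b + c < pi"
  shows "\<exists>T. has_angles T (a, b, c)"
proof -
  define x where "x = (cos a + cos b * cos c) / (sin b * sin c)"
  define y where "y = (cos b + cos c * cos a) / (sin c * sin a)"
  define z where "z = (cos c + cos a * cos b) / (sin a * sin b)"
  \<comment> \<open>sinh^2 of each side is \<open>G\<close> over the squared product of the sines at
    its ends.\<close>
  define G where "G = (cos a)\<^sup>2 + (cos b)\<^sup>2 + (cos c)\<^sup>2 + 2 * cos a * cos b * cos c - 1"
  define g where "g = sqrt G"
  have s: "sin a > 0" "sin b > 0" "sin c > 0" using assms by (simp_all add: sin_gt_zero)
  have xyz: "x > 1" "y > 1" "z > 1"
    using law_of_cosines_gt_1[of a b c] law_of_cosines_gt_1[of b c a] law_of_cosines_gt_1[of c a b]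
      assms by (simp_all add: x_def y_def z_def)
  have sq: "(sin a)\<^sup>2 = 1 - (cos a)\<^sup>2" "(sin b)\<^sup>2 = 1 - (cos b)\<^sup>2" "(sin c)\<^sup>2 = 1 - (cos c)\<^sup>2"
    by (simp_all add: sin_squared_eq)
  have key: "((cos u + cos v * cos w) / (sin v * sin w))\<^sup>2 - 1
      = ((cos u)\<^sup>2 + (cos v)\<^sup>2 + (cos w)\<^sup>2 + 2 * cos u * cos v * cos w - 1) / (sin v * sin w)\<^sup>2"
    if "sin v > 0" "sin w > 0" for u v w :: real
  proof -
    have "(sin v * sin w)\<^sup>2 = (1 - (cos v)\<^sup>2) * (1 - (cos w)\<^sup>2)"
      by (simp add: power_mult_distrib sin_squared_eq)
    then have "(cos u + cos v * cos w)\<^sup>2 - (sin v * sin w)\<^sup>2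
        = (cos u)\<^sup>2 + (cos v)\<^sup>2 + (cos w)\<^sup>2 + 2 * cos u * cos v * cos w - 1"
      by Groebner_Basis.algebra
    moreover have "(sin v * sin w)\<^sup>2 \<noteq> 0" using that by simp
    ultimately show ?thesis
      by (simp only: power_divide diff_divide_distrib[symmetric] divide_self[symmetric])
  qed
  have G: "x\<^sup>2 - 1 = G / (sin b * sin c)\<^sup>2" "y\<^sup>2 - 1 = G / (sin c * sin a)\<^sup>2"
    "z\<^sup>2 - 1 = G / (sin a * sin b)\<^sup>2"
    using key[OF s(2,3), of a] key[OF s(3,1), of b] key[OF s(1,2), of c]
    by (simp_all add: x_def y_def z_def G_def mult_ac add_ac)
  have "G / (sin b * sin c)\<^sup>2 > 0" using xyz(1) by (simp add: one_less_power flip: G)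
  then have G0: "G > 0" using s by (simp add: zero_less_divide_iff)
  then have g: "g > 0" "g\<^sup>2 = G" by (simp_all add: g_def)
  have r: "sqrt (x\<^sup>2 - 1) = g / (sin b * sin c)" "sqrt (y\<^sup>2 - 1) = g / (sin c * sin a)"
    "sqrt (z\<^sup>2 - 1) = g / (sin a * sin b)"
    using s by (simp_all add: G g_def real_sqrt_divide)
  define E where "E = (vector [vector [0, - 1], vector [1, 0]] :: real^2^2)"
  define u where "u = (vector [vector [0, - 1], vector [- 1, 0]] :: real^2^2)"
  define n where "n = (vector [vector [1, 0], vector [0, - 1]] :: real^2^2)"
  have basis: "mform E E = 1" "mform u u = - 1" "mform n n = - 1"
    "mform E u = 0" "mform E n = 0" "mform u n = 0" "mform u E = 0" "mform n E = 0" "mform n u = 0"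
    by (simp_all add: E_def u_def n_def mform_def)
  define v where "v = sqrt (y\<^sup>2 - 1)"
  define w where "w = sqrt (z\<^sup>2 - 1)"
  have v2: "v\<^sup>2 = y\<^sup>2 - 1" and w2: "w\<^sup>2 = z\<^sup>2 - 1" and vw: "v \<ge> 0" "w \<ge> 0"
    using xyz one_less_power[of y 2] one_less_power[of z 2] by (simp_all add: v_def w_def less_imp_le)
  have vwlt: "v < y" "w < z"
    using v2 w2 vw xyz power2_less_imp_less[of v y] power2_less_imp_less[of w z] by auto
  define MB where "MB = z *\<^sub>R E + w *\<^sub>R u"
  define MC where "MC = y *\<^sub>R E + (v * cos a) *\<^sub>R u + (v * sin a) *\<^sub>R n"
  define A where "A = hpoint E"
  define B where "B = hpoint MB"
  define C where "C = hpoint MC"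
  have "v * cos a \<le> v" using vw(1) by (simp add: mult_left_le)
  then have pos: "E$2$1 > 0" "MB$2$1 > 0" "MC$2$1 > 0"
    using vwlt by (simp_all add: E_def MB_def MC_def u_def n_def)
  have tr: "E$2$2 = - E$1$1" "MB$2$2 = - MB$1$1" "MC$2$2 = - MC$1$1"
    by (simp_all add: E_def MB_def MC_def u_def n_def)
  have norm: "mform E E = 1" "mform MB MB = 1" "mform MC MC = 1"
  proof -
    show "mform E E = 1" by (rule basis)
    show "mform MB MB = 1"
      using w2 by (simp add: MB_def mform_linear basis algebra_simps power2_eq_square)
    have "mform MC MC = y * y - v * cos a * (v * cos a) - v * sin a * (v * sin a)"
      by (simp add: MC_def mform_linear basis)
    also have "\<dots> = y\<^sup>2 - v\<^sup>2 * ((cos a)\<^sup>2 + (sin a)\<^sup>2)"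
      by Groebner_Basis.algebra
    finally show "mform MC MC = 1" by (simp add: v2 add.commute)
  qed
  have H2: "A \<in> H2" "B \<in> H2" "C \<in> H2"
    and J: "J A = E" "J B = MB" "J C = MC"
    using hpoint[OF tr(1) norm(1) pos(1)] hpoint[OF tr(2) norm(2) pos(2)]
      hpoint[OF tr(3) norm(3) pos(3)] by (simp_all add: A_def B_def C_def)
  have AB: "mform (J A) (J B) = z" and AC: "mform (J A) (J C) = y"
    by (simp_all add: J MB_def MC_def mform_linear basis)
  have "mform (J B) (J C) = y * z - v * w * cos a"
    by (simp add: J MB_def MC_def mform_linear basis algebra_simps)
  also have "v * w * cos a = G * cos a / ((sin c * sin a) * (sin a * sin b))"
    unfolding v_def w_def r g(2)[symmetric] by (simp add: power2_eq_square)
  also have "y * z - \<dots> = x"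
  proof -
    have "(cos b + cos c * cos a) * (cos c + cos a * cos b) - G * cos a
        = (cos a + cos b * cos c) * (sin a)\<^sup>2"
      unfolding G_def sq by Groebner_Basis.algebra
    then have "((cos b + cos c * cos a) * (cos c + cos a * cos b) - G * cos a)
        / ((sin a)\<^sup>2 * (sin b * sin c)) = x"
      using s by (simp add: x_def)
    then show ?thesis
      by (simp add: y_def z_def diff_divide_distrib power2_eq_square mult_ac)
  qed
  finally have BC: "mform (J B) (J C) = x" .
  have "A \<noteq> B" "B \<noteq> C" "C \<noteq> A"
    using AB AC BC xyz mform_J_self H2 by auto
  \<comment> \<open>The first law of cosines returns the cosine \<open>p\<close> at one vertex;
    \<open>q\<close> and \<open>r\<close> are the other two cosines, and cyclic renaming covers all
    vertices.\<close>
  have ratio: "((q + r * p) / (s'' * s) * ((r + p * q) / (s * s')) - (p + q * r) / (s' * s''))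
      / (g / (s'' * s) * (g / (s * s'))) = p"
    if "s > 0" "s' > 0" "s'' > 0" "s\<^sup>2 = 1 - p\<^sup>2"
      "g\<^sup>2 = p\<^sup>2 + q\<^sup>2 + r\<^sup>2 + 2 * p * q * r - 1" for p q r s s' s'' :: real
  proof -
    have "(q + r * p) * (r + p * q) - (p + q * r) * s\<^sup>2 = g\<^sup>2 * p"
      unfolding that(4,5) by Groebner_Basis.algebra
    moreover have "(q + r * p) / (s'' * s) * ((r + p * q) / (s * s')) - (p + q * r) / (s' * s'')
        = ((q + r * p) * (r + p * q) - (p + q * r) * s\<^sup>2) / (s' * s'' * s\<^sup>2)"
      using that(1-3) by (simp add: diff_divide_distrib power2_eq_square mult_ac)
    ultimately show ?thesis using that(1-3) g(1) by (simp add: power2_eq_square)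
  qed
  have ang: "hangle A B C = arccos ((y * z - x) / (sqrt (y\<^sup>2 - 1) * sqrt (z\<^sup>2 - 1)))"
    "hangle B C A = arccos ((z * x - y) / (sqrt (z\<^sup>2 - 1) * sqrt (x\<^sup>2 - 1)))"
    "hangle C A B = arccos ((x * y - z) / (sqrt (x\<^sup>2 - 1) * sqrt (y\<^sup>2 - 1)))"
    using hangle_eq[OF H2(1,2,3)] hangle_eq[OF H2(2,3,1)] hangle_eq[OF H2(3,1,2)] AB AC BC
      \<open>A \<noteq> B\<close> \<open>B \<noteq> C\<close> \<open>C \<noteq> A\<close> mform_commute[of "J B" "J A"] mform_commute[of "J C" "J A"]
      mform_commute[of "J C" "J B"]
    by (simp_all add: mult.commute)
  have g': "g\<^sup>2 = (cos b)\<^sup>2 + (cos c)\<^sup>2 + (cos a)\<^sup>2 + 2 * cos b * cos c * cos a - 1"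
    "g\<^sup>2 = (cos c)\<^sup>2 + (cos a)\<^sup>2 + (cos b)\<^sup>2 + 2 * cos c * cos a * cos b - 1"
    by (simp_all add: g G_def)
  have "hangle A B C = a" "hangle B C A = b" "hangle C A B = c"
    unfolding ang r
    using ratio[OF s sq(1) g(2)[unfolded G_def]] ratio[OF s(2,3,1) sq(2) g'(1)]
      ratio[OF s(3,1,2) sq(3) g'(2)] assms
    by (simp_all only: x_def[symmetric] y_def[symmetric] z_def[symmetric]) (simp_all add: arccos_cos)
  then have "has_angles (A, B, C) (a, b, c)"
    using H2 \<open>A \<noteq> B\<close> \<open>B \<noteq> C\<close> \<open>C \<noteq> A\<close> by (simp add: has_angles_def)
  then show ?thesis by blast
qed

section \<open>The action of the side involutions\<close>

fun angle_at :: "real \<times> real \<times> real \<Rightarrow> gen \<Rightarrow> real" where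
  "angle_at (a, b, c) GP = a"
| "angle_at (a, b, c) GQ = b"
| "angle_at (a, b, c) GR = c"

context hyperbolic_triangle
begin

definition H :: "gen \<Rightarrow> real^2^2" where
  "H x = (case x of GP \<Rightarrow> J (hmidpoint B C) | GQ \<Rightarrow> J (hmidpoint C A) | GR \<Rightarrow> J (hmidpoint A B))"

definition E :: "gen \<Rightarrow> real^2^2" where
  "E x = (case x of GP \<Rightarrow> J B + J C | GQ \<Rightarrow> J C + J A | GR \<Rightarrow> J A + J B)"

definition h :: "gen \<Rightarrow> real" where
  "h x = (case x of GP \<Rightarrow> ha | GQ \<Rightarrow> hb | GR \<Rightarrow> hc)"

lemma midpoints_H2: "hmidpoint B C \<in> H2" "hmidpoint C A \<in> H2" "hmidpoint A B \<in> H2"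
  using hmidpoint_in_H2 H2 distinct by simp_all

lemma H_eq: "H x = (1 / sqrt (2 * (1 + h x))) *\<^sub>R E x"
  using H2 distinct by (cases x) (simp_all add: H_def E_def h_def J_hmidpoint ha_def hb_def hc_def)

lemma H_trace: "H x$2$2 = - H x$1$1"
  by (cases x) (simp_all add: H_def)

lemma H_square: "H x ** H x = - mat 1"
  using midpoints_H2 by (cases x) (simp_all add: H_def half_turn_matrix_square)

lemma det_H: "det (H x) = 1"
  using midpoints_H2 by (cases x) (simp_all add: H_def det_half_turn_matrix)

lemma side_involution_H: "side_involution (A, B, C) x = {H x, - H x}"
  using midpoints_H2 by (cases x) (simp_all add: H_def hrotation_pi)

lemma side_involution_closed: "side_involution (A, B, C) x \<in> carrier PSL2R"
  using midpoints_H2 by (cases x) (simp_all add: hrotation_pi_closed)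

lemma side_involution_square:
  "side_involution (A, B, C) x \<otimes>\<^bsub>PSL2R\<^esub> side_involution (A, B, C) x = \<one>\<^bsub>PSL2R\<^esub>"
  using midpoints_H2 by (cases x) (simp_all add: hrotation_pi_square)

definition comb :: "(gen \<Rightarrow> real) \<Rightarrow> real^2^2" where
  "comb v = v GP *\<^sub>R E GP + v GQ *\<^sub>R E GQ + v GR *\<^sub>R E GR"

lemma mform_E: "mform (E x) (E y) = (if x = y then 2 * (1 + h x) else S)"
proof -
  have "mform (J B) (J B) = 1" "mform (J A) (J A) = 1" "mform (J C) (J C) = 1"
    by (simp_all add: mform_J_self H2)
  moreover have "mform (J B) (J C) = ha" "mform (J C) (J B) = ha" "mform (J C) (J A) = hb"
    "mform (J A) (J C) = hb" "mform (J A) (J B) = hc" "mform (J B) (J A) = hc"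
    by (simp_all add: ha_def hb_def hc_def mform_commute)
  ultimately show ?thesis
    by (cases x; cases y) (simp_all add: E_def h_def S_def mform_linear)
qed

lemma h_gen_gt_1: "h x > 1"
  using h_gt_1 by (cases x) (simp_all add: h_def)

text \<open>The normalisation of \<open>H x\<close> occurs twice in the half-turn, so its square
  root disappears.\<close>

lemma H_comb: "H x ** comb v = comb (turn (\<lambda>x. S / (1 + h x)) x v) ** H x"
proof -
  have 1: "1 + h x > 0" using h_gen_gt_1[of x] by simp
  have "(2 * mform (H x) (comb v)) *\<^sub>R H x = (mform (E x) (comb v) / (1 + h x)) *\<^sub>R E x"
  proof -
    define r where "r = sqrt (2 * (1 + h x))"
    have "r * r = 2 * (1 + h x)" using 1 by (simp add: r_def)
    moreover have "(2 * mform (H x) (comb v)) *\<^sub>R H x = (2 * mform (E x) (comb v) / (r * r)) *\<^sub>R E x"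
      unfolding H_eq r_def[symmetric] mform_linear by simp
    ultimately show ?thesis by (simp only: mult_divide_mult_cancel_left)
  qed
  also have "mform (E x) (comb v) = 2 * (1 + h x) * v x + S * (v GP + v GQ + v GR - v x)"
    by (cases x) (simp_all add: comb_def mform_linear mform_E algebra_simps)
  also have "\<dots> / (1 + h x) = 2 * v x + S / (1 + h x) * (v GP + v GQ + v GR - v x)"
    using 1 by (simp add: field_simps)
  finally have "(2 * mform (H x) (comb v)) *\<^sub>R H x - comb v
      = (2 * v x + S / (1 + h x) * (v GP + v GQ + v GR - v x)) *\<^sub>R E x - comb v"
    by simp
  also have "\<dots> = comb (turn (\<lambda>x. S / (1 + h x)) x v)"
    by (cases x) (simp_all add: comb_def turn_def mat2_eq_iff algebra_simps)
  finally show ?thesis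
    using half_turn_conj[OF H_trace _ H_square, of "comb v" x]
    by (simp add: comb_def E_def algebra_simps)
qed

lemma mword_comb: "mword H w ** comb (\<lambda>_. 1) = comb (act (\<lambda>x. S / (1 + h x)) w) ** mword H w"
proof (induction w)
  case (Cons x w)
  have "mword H (x # w) ** comb (\<lambda>_. 1) = H x ** (mword H w ** comb (\<lambda>_. 1))"
    by (simp add: mword_def matrix_mul_assoc)
  also have "\<dots> = (H x ** comb (act (\<lambda>x. S / (1 + h x)) w)) ** mword H w"
    unfolding Cons by (simp add: matrix_mul_assoc)
  also have "\<dots> = comb (act (\<lambda>x. S / (1 + h x)) (x # w)) ** mword H (x # w)"
    unfolding H_comb by (simp add: act_Cons mword_def matrix_mul_assoc)
  finally show ?case .
qed (simp add: mword_def act_Nil)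

text \<open>The Gram matrix of the three vectors has determinant \<delta>^2, which is
  nonzero.\<close>

lemma J_independent:
  assumes "x *\<^sub>R J A + y *\<^sub>R J B + z *\<^sub>R J C = 0"
  shows "x = 0" "y = 0" "z = 0"
proof -
  have "mform (J A) (J B) = hc" "mform (J B) (J A) = hc" "mform (J B) (J C) = ha"
    "mform (J C) (J B) = ha" "mform (J A) (J C) = hb" "mform (J C) (J A) = hb"
    by (simp_all add: ha_def hb_def hc_def mform_commute)
  moreover have "mform (x *\<^sub>R J A + y *\<^sub>R J B + z *\<^sub>R J C) M = 0" for M
    unfolding assms by (simp add: mform_def)
  from this[of "J A"] this[of "J B"] this[of "J C"]
  have "x + y * hc + z * hb = 0" "x * hc + y + z * ha = 0" "x * hb + y * ha + z = 0"
    by (simp_all add: mform_linear mform_J_self H2 calculation)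
  then have "x * \<delta>\<^sup>2 = 0" "y * \<delta>\<^sup>2 = 0" "z * \<delta>\<^sup>2 = 0"
    unfolding delta2 by Groebner_Basis.algebra+
  then show "x = 0" "y = 0" "z = 0" using delta_nonzero by simp_all
qed

lemma comb_inj: "comb u = comb v \<Longrightarrow> u = v"
proof -
  assume eq: "comb u = comb v"
  define d where "d x = u x - v x" for x
  have "(d GQ + d GR) *\<^sub>R J A + (d GP + d GR) *\<^sub>R J B + (d GP + d GQ) *\<^sub>R J C
      = comb u - comb v"
    by (simp add: comb_def E_def d_def algebra_simps)
  from J_independent[OF this[unfolded eq diff_self]] have "d GP = 0" "d GQ = 0" "d GR = 0"
    by simp_all
  then have "u x = v x" for x by (cases x) (simp_all add: d_def)
  then show ?thesis ..
qed

lemma kappa_gen: "S / (1 + h x) = kappa \<phi> (angle_at (\<alpha>, \<beta>, \<gamma>) x)"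
  using kappa_eqs by (cases x) (simp_all add: h_def)

lemma word_value_one:
  "word_value (side_involution (A, B, C)) w = \<one>\<^bsub>PSL2R\<^esub> \<longleftrightarrow>
    mword H w = mat 1 \<or> mword H w = - mat 1"
  by (rule word_value_one_iff[OF det_H side_involution_H])

lemma act_trivial_if_word_trivial:
  assumes "word_value (side_involution (A, B, C)) w = \<one>\<^bsub>PSL2R\<^esub>"
  shows "act (\<lambda>x. kappa \<phi> (angle_at (\<alpha>, \<beta>, \<gamma>) x)) w = (\<lambda>_. 1)"
proof -
  have "comb (\<lambda>_. 1) = comb (act (\<lambda>x. S / (1 + h x)) w)"
    using assms mword_comb[of w] unfolding word_value_one by (auto simp: minus_mat_mult)
  then show ?thesis using comb_inj kappa_gen by simp
qed

end

lemma side_hom_triangle: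
  assumes "\<eta> \<in> triangle_angles \<phi>" "0 < \<phi>" "\<phi> < pi"
  obtains A B C \<alpha> \<beta> \<gamma> where "\<eta> = (\<alpha>, \<beta>, \<gamma>)" "hyperbolic_triangle A B C \<alpha> \<beta> \<gamma> \<phi>"
    "side_hom \<eta> = rep_of (side_involution (A, B, C))"
proof -
  obtain \<alpha> \<beta> \<gamma> where \<eta>: "\<eta> = (\<alpha>, \<beta>, \<gamma>)" by (cases \<eta>)
  define T where "T = (SOME T. has_angles T \<eta>)"
  have "\<exists>T. has_angles T \<eta>"
    unfolding \<eta> using assms by (intro triangle_exists) (auto simp: triangle_angles_def \<eta>)
  then have T: "has_angles T \<eta>" unfolding T_def by (rule someI_ex)
  obtain A B C where ABC: "T = (A, B, C)" by (cases T)
  have "hyperbolic_triangle A B C \<alpha> \<beta> \<gamma> \<phi>"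
    using T assms by unfold_locales (simp_all add: ABC \<eta>)
  then show ?thesis
    using that[OF \<eta>] by (simp add: side_hom_def ABC flip: T_def)
qed

lemma side_hom_inj:
  assumes \<eta>: "\<eta> \<in> triangle_angles \<phi>" "0 < \<phi>" "\<phi> < pi"
    and nontrivial: "\<And>w. distinct_adj w \<Longrightarrow> w \<noteq> [] \<Longrightarrow>
      act (\<lambda>x. kappa \<phi> (angle_at \<eta> x)) w \<noteq> (\<lambda>_. 1)"
  shows "inj_on (side_hom \<eta>) (carrier W)"
proof -
  from side_hom_triangle[OF \<eta>] obtain A B C \<alpha> \<beta> \<gamma> where eq: "\<eta> = (\<alpha>, \<beta>, \<gamma>)"
    and "hyperbolic_triangle A B C \<alpha> \<beta> \<gamma> \<phi>"
    and hom: "side_hom \<eta> = rep_of (side_involution (A, B, C))" .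
  then interpret hyperbolic_triangle A B C \<alpha> \<beta> \<gamma> \<phi> by simp
  note rep = rep_of_hom[OF side_involution_closed side_involution_square]
    and rep_class = rep_of_wclass[OF side_involution_closed side_involution_square]
  interpret group_hom W PSL2R "side_hom \<eta>"
    using group_W group_PSL2R rep by (simp add: group_hom_def group_hom_axioms_def hom)
  show ?thesis
    unfolding inj_on_one_iff
  proof (intro allI impI)
    fix X assume "X \<in> carrier W" and X1: "side_hom \<eta> X = \<one>\<^bsub>PSL2R\<^esub>"
    then obtain u where u: "X = wclass u" unfolding carrier_W by blast
    obtain w where w: "distinct_adj w" "weq u w" using reduced_word_exists by blast
    then have X: "X = wclass w" by (simp add: u wclass_eq_iff)
    have "word_value (side_involution (A, B, C)) w = \<one>\<^bsub>PSL2R\<^esub>"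
      using X1 by (simp add: hom X rep_class)
    from act_trivial_if_word_trivial[OF this] have "w = []"
      using nontrivial[OF w(1)] by (auto simp: eq)
    then show "X = \<one>\<^bsub>W\<^esub>" by (simp add: X one_W)
  qed
qed

section \<open>Injectivity for very general triangles\<close>

lemma dense_in_top_of_setI:
  fixes T :: "'a::metric_space set"
  assumes "\<And>x e. x \<in> T \<Longrightarrow> e > 0 \<Longrightarrow> \<exists>y\<in>S \<inter> T. dist y x < e"
  shows "dense_in_space (top_of_set T) S"
proof -
  have "x \<in> top_of_set T closure_of S" if "x \<in> T" for x
    unfolding in_closure_of
  proof (intro conjI allI impI)
    show "x \<in> topspace (top_of_set T)" using that by simp
    fix U assume "x \<in> U \<and> openin (top_of_set T) U"
    then obtain V where V: "open V" "U = T \<inter> V" "x \<in> V" by (auto simp: openin_open)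
    then obtain e where "e > 0" "ball x e \<subseteq> V" by (meson open_contains_ball)
    then show "\<exists>y. y \<in> S \<and> y \<in> U"
      using assms[OF that \<open>e > 0\<close>] V by (auto simp: dist_commute subset_iff)
  qed
  then show ?thesis
    unfolding dense_in_space_def
    using closure_of_subset_topspace[of "top_of_set T" S] by auto
qed

lemma triangle_angles_Int:
  "triangle_angles \<phi> = {x. fst x + fst (snd x) + snd (snd x) = pi - \<phi>} \<inter>
    ({0<..<pi} \<times> {0<..<pi} \<times> {0<..<pi})"
  by (auto simp: triangle_angles_def)

text \<open>The space need not be closed, since angles may tend to 0; but a closed plane cut by an
  open cube is locally compact, and that form of Baire's theorem applies.\<close>

lemma Baire_triangle_angles:
  assumes "countable \<G>"
    and "\<And>U. U \<in> \<G> \<Longrightarrow> openin (top_of_set (triangle_angles \<phi>)) U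
      \<and> dense_in_space (top_of_set (triangle_angles \<phi>)) U"
  shows "dense_in_space (top_of_set (triangle_angles \<phi>)) (\<Inter>\<G>)"
proof -
  let ?C = "{x :: real \<times> real \<times> real. fst x + fst (snd x) + snd (snd x) = pi - \<phi>}"
  have "closed ?C"
    by (intro closed_Collect_eq continuous_intros)
  moreover have "open ({0<..<pi} \<times> {0<..<pi} \<times> {0<..<pi})"
    by (intro open_Times open_greaterThanLessThan)
  ultimately have "\<exists>C U. closedin euclidean C \<and> openin euclidean U \<and> C \<inter> U = triangle_angles \<phi>"
    unfolding triangle_angles_Int using closed_closedin open_openin by blast
  then have "locally_compact_space (top_of_set (triangle_angles \<phi>))"
    using locally_compact_subspace_closed_Int_openin_eq[OF Hausdorff_space_euclidean
        locally_compact_space_euclidean] by blast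
  moreover have "regular_space (top_of_set (triangle_angles \<phi>))"
    by (intro regular_space_subtopology regular_space_euclidean)
  ultimately show ?thesis
    unfolding dense_in_space_def using Baire_category[of "top_of_set (triangle_angles \<phi>)" \<G>] assms
    unfolding dense_in_space_def by blast
qed

section \<open>Analytic dependence of the action on the angles\<close>

lemma act_holomorphic:
  assumes "\<And>x. \<kappa> x holomorphic_on S"
  shows "(\<lambda>z. act (\<lambda>x. \<kappa> x z) w y) holomorphic_on S"
proof (induction w arbitrary: y)
  case (Cons x w)
  show ?case
    by (cases "y = x") (auto simp: act_Cons turn_def intro!: holomorphic_intros Cons assms)
qed (simp add: act_Nil)

lemma act_continuous:
  fixes \<kappa> :: "gen \<Rightarrow> 'a::topological_space \<Rightarrow> real"
  assumes "\<And>x. continuous_on S (\<kappa> x)"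
  shows "continuous_on S (\<lambda>z. act (\<lambda>x. \<kappa> x z) w y)"
proof (induction w arbitrary: y)
  case (Cons x w)
  show ?case
    by (cases "y = x") (auto simp: act_Cons turn_def intro!: continuous_intros Cons assms)
qed (simp add: act_Nil)

definition word_act :: "real \<Rightarrow> gen list \<Rightarrow> real \<times> real \<times> real \<Rightarrow> gen \<Rightarrow> real" where
  "word_act \<phi> w \<eta> = act (\<lambda>x. kappa \<phi> (angle_at \<eta> x)) w"

lemma angle_at_in: "\<eta> \<in> triangle_angles \<phi> \<Longrightarrow> angle_at \<eta> x \<in> {0<..<pi}"
  by (cases x) (auto simp: triangle_angles_def)

lemma word_act_continuous: "continuous_on (triangle_angles \<phi>) (\<lambda>\<eta>. word_act \<phi> w \<eta> y)"
proof -
  have "angle_at \<eta> x = (case x of GP \<Rightarrow> fst \<eta> | GQ \<Rightarrow> fst (snd \<eta>) | GR \<Rightarrow> snd (snd \<eta>))" for \<eta> x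
    by (cases \<eta>; cases x) simp_all
  then have "continuous_on (triangle_angles \<phi>) (\<lambda>\<eta>. angle_at \<eta> x)" for x
    by (cases x) (auto intro!: continuous_intros)
  moreover have "sin (angle_at \<eta> x) \<noteq> 0" if "\<eta> \<in> triangle_angles \<phi>" for \<eta> x
    using angle_at_in[OF that, of x] sin_gt_zero[of "angle_at \<eta> x"] by simp
  ultimately show ?thesis
    unfolding word_act_def kappa_def by (intro act_continuous continuous_intros) auto
qed

text \<open>Along a segment in the space of triangles the matrix entries extend holomorphically to
  a vertical strip.\<close>

lemma word_act_identity:
  assumes \<eta>: "\<eta>0 \<in> triangle_angles \<phi>" "\<eta>1 \<in> triangle_angles \<phi>"
    and "e > 0" and near: "\<And>\<eta>. \<eta> \<in> triangle_angles \<phi> \<Longrightarrow> dist \<eta> \<eta>0 < e \<Longrightarrow> word_act \<phi> w \<eta> = (\<lambda>_. 1)"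
  shows "word_act \<phi> w \<eta>1 = (\<lambda>_. 1)"
proof
  fix y
  define a where "a x = angle_at \<eta>0 x" for x
  define b where "b x = angle_at \<eta>1 x - angle_at \<eta>0 x" for x
  \<comment> \<open>Here the real part of the complexified angle lies strictly between 0 and pi;
    half-planes make the set open and convex.\<close>
  define P where "P x = {z. inner (Complex (b x) 0) z > - a x} \<inter> {z. inner (Complex (b x) 0) z < pi - a x}"
    for x
  define S where "S = P GP \<inter> P GQ \<inter> P GR"
  define \<kappa> where "\<kappa> x z = 1 + complex_of_real (cos \<phi>) + complex_of_real (sin \<phi>) *
    (cos (of_real (a x) + z * of_real (b x)) / sin (of_real (a x) + z * of_real (b x)))" for x z
  define F where "F z = act (\<lambda>x. \<kappa> x z) w y - 1" for z
  have "open (P x) \<and> convex (P x)" for x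
    unfolding P_def
    by (intro conjI open_Int convex_Int open_halfspace_gt open_halfspace_lt
        convex_halfspace_gt convex_halfspace_lt)
  then have S: "open S" "connected S"
    unfolding S_def by (auto intro!: convex_connected convex_Int)
  have sin: "sin (of_real (a x) + z * of_real (b x)) \<noteq> 0" if "z \<in> S" for x z
  proof
    assume "sin (of_real (a x) + z * of_real (b x)) = 0"
    \<comment> \<open>All zeros of the complex sine are real multiples of pi, which the real part
      excludes.\<close>
    then obtain n :: int where "of_real (a x) + z * of_real (b x) = of_real (of_int n * pi)"
      unfolding sin_eq_0 by auto
    from arg_cong[OF this, of Re] have n: "a x + Re z * b x = of_int n * pi" by simp
    have "0 < a x + Re z * b x" "a x + Re z * b x < pi"
      using that by (cases x; auto simp: S_def P_def inner_complex_def mult.commute)+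
    then have "0 < of_int n * pi" "of_int n * pi < 1 * pi" using n by auto
    then have "(0 :: real) < of_int n" "of_int n < (1 :: real)"
      using pi_gt_zero by (simp_all add: zero_less_mult_iff)
    then show False by simp
  qed
  have hol: "F holomorphic_on S"
    unfolding F_def \<kappa>_def
    by (intro holomorphic_intros act_holomorphic) (use sin in auto)
  define path where "path t = (a GP + t * b GP, a GQ + t * b GQ, a GR + t * b GR)" for t
  have ends: "path 0 = \<eta>0" "path 1 = \<eta>1"
    by (cases \<eta>0; cases \<eta>1; simp add: path_def a_def b_def)+
  have angle_path: "angle_at (path t) x = a x + t * b x" for t x
    by (cases x) (simp_all add: path_def)
  have F: "F (of_real t) = of_real (word_act \<phi> w (path t) y - 1)" for t
  proof -
    have "complex_of_real (word_act \<phi> w (path t) y)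
        = act (\<lambda>x. complex_of_real (kappa \<phi> (angle_at (path t) x))) w y"
      unfolding word_act_def by (rule act_ring_hom) simp_all
    moreover have "complex_of_real (kappa \<phi> (angle_at (path t) x)) = \<kappa> x (of_real t)" for x
      by (simp add: \<kappa>_def kappa_def angle_path flip: cos_of_real sin_of_real)
    ultimately show ?thesis by (simp add: F_def)
  qed
  have in_T: "path t \<in> triangle_angles \<phi>" if "0 \<le> t" "t \<le> 1" for t
  proof -
    have conv: "0 < p + t * (q - p) \<and> p + t * (q - p) < pi"
      if "p \<in> {0<..<pi}" "q \<in> {0<..<pi}" for p q
      using convexD[OF convex_real_interval(8) that, of "1 - t" t] \<open>0 \<le> t\<close> \<open>t \<le> 1\<close>
      by (simp add: algebra_simps)
    have *: "a x + t * b x \<in> {0<..<pi}" for x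
      using conv[OF angle_at_in[OF \<eta>(1)] angle_at_in[OF \<eta>(2)], of x x]
      by (simp add: a_def b_def)
    have "a GP + a GQ + a GR = pi - \<phi>" "b GP + b GQ + b GR = 0"
      using \<eta> by (auto simp: triangle_angles_def a_def b_def)
    then have "a GP + t * b GP + (a GQ + t * b GQ) + (a GR + t * b GR) = pi - \<phi> + t * 0"
      by (simp only: distrib_left[symmetric] flip: \<open>b GP + b GQ + b GR = 0\<close>) (simp add: algebra_simps)
    then show ?thesis
      using *[of GP] *[of GQ] *[of GR] by (simp add: path_def triangle_angles_def)
  qed
  have in_S: "of_real t \<in> S" if "0 \<le> t" "t \<le> 1" for t
  proof -
    have "- a x < b x * t \<and> b x * t < pi - a x" for x
      using angle_at_in[OF in_T[OF that], of x] unfolding angle_path by (auto simp: mult.commute)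
    then show ?thesis by (simp add: S_def P_def inner_complex_def)
  qed
  have "continuous (at 0) path"
    unfolding path_def by (intro continuous_intros)
  then obtain r where "r > 0" and r: "\<And>t. \<bar>t\<bar> < r \<Longrightarrow> dist (path t) \<eta>0 < e"
    using \<open>e > 0\<close> unfolding continuous_at_eps_delta ends[symmetric] dist_real_def by force
  \<comment> \<open>One-sided, because the path is known to stay among the triangles only for
    parameters in [0, 1]; accumulation at 0 suffices for the identity theorem.\<close>
  define U where "U = complex_of_real ` {0<..<min r 1}"
  have "F 1 = 0"
  proof (rule analytic_continuation[OF hol S])
    show "U \<subseteq> S" using in_S by (auto simp: U_def)
    show "0 \<in> S" "1 \<in> S" using in_S[of 0] in_S[of 1] by simp_all
    show "0 islimpt U"
      unfolding islimpt_approachable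
    proof (intro allI impI)
      fix d :: real assume "d > 0"
      define t where "t = min d (min r 1) / 2"
      have "t > 0" "t < d" "t < min r 1" using \<open>d > 0\<close> \<open>r > 0\<close> by (auto simp: t_def)
      then show "\<exists>x'\<in>U. x' \<noteq> 0 \<and> dist x' 0 < d"
        by (intro bexI[of _ "of_real t"]) (auto simp: U_def)
    qed
    fix z assume "z \<in> U"
    then obtain t where t: "z = of_real t" "0 < t" "t < r" "t < 1" by (auto simp: U_def)
    then have "word_act \<phi> w (path t) = (\<lambda>_. 1)"
      by (intro near in_T r) auto
    then show "F z = 0" by (simp add: t F)
  qed
  then show "word_act \<phi> w \<eta>1 y = 1"
    using F[of 1] by (simp add: ends)
qed

section \<open>Equilateral triangles and exceptional areas\<close>

lemma kappa_equilateral: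
  assumes "0 < \<phi>" "\<phi> < pi"
  shows "kappa \<phi> ((pi - \<phi>) / 3) = 1 + 2 * cos ((pi - \<phi>) / 3)"
proof -
  define a where "a = (pi - \<phi>) / 3"
  have "sin a > 0" using assms by (intro sin_gt_zero) (auto simp: a_def)
  have "\<phi> = pi - 3 * a" by (simp add: a_def field_simps)
  \<comment> \<open>The angle sum gives a + \<phi> = pi - 2 a.\<close>
  then have "sin (a + \<phi>) = sin (2 * a)" using sin_pi_minus[of "2 * a"] by simp
  then have "cos a * sin \<phi> = 2 * sin a * cos a - sin a * cos \<phi>"
    unfolding sin_add sin_double by simp
  then have "sin \<phi> * (cos a / sin a) = 2 * cos a - cos \<phi>"
    using \<open>sin a > 0\<close> by (simp add: field_simps)
  then show ?thesis unfolding kappa_def a_def[symmetric] by simp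
qed

definition bad_areas :: "gen list \<Rightarrow> real set" where
  "bad_areas w = {\<phi>\<in>{0<..<pi}. act (\<lambda>_. kappa \<phi> ((pi - \<phi>) / 3)) w = (\<lambda>_. 1)}"

lemma finite_bad_areas:
  assumes "distinct_adj w" "w \<noteq> []"
  shows "finite (bad_areas w)"
proof (rule inj_on_finite)
  show "inj_on (\<lambda>\<phi>. 1 + 2 * cos ((pi - \<phi>) / 3)) (bad_areas w)"
  proof (rule inj_onI)
    fix s t assume "s \<in> bad_areas w" "t \<in> bad_areas w"
      and eq: "1 + 2 * cos ((pi - s) / 3) = 1 + 2 * cos ((pi - t) / 3)"
    then have "0 < s" "s < pi" "0 < t" "t < pi" by (simp_all add: bad_areas_def)
    then have "(pi - s) / 3 = (pi - t) / 3"
      using eq cos_inj_pi[of "(pi - s) / 3" "(pi - t) / 3"] by simp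
    then show "s = t" by simp
  qed
  show "(\<lambda>\<phi>. 1 + 2 * cos ((pi - \<phi>) / 3)) ` bad_areas w \<subseteq> {\<xi>. act (\<lambda>_. \<xi>) w = (\<lambda>_. 1)}"
    by (auto simp: bad_areas_def kappa_equilateral)
  show "finite {\<xi> :: real. act (\<lambda>_. \<xi>) w = (\<lambda>_. 1)}"
    by (rule finite_act_trivial[OF assms])
qed

lemma very_general_injective:
  assumes \<phi>: "0 < \<phi>" "\<phi> < pi"
    and good: "\<And>w. distinct_adj w \<Longrightarrow> w \<noteq> [] \<Longrightarrow> \<phi> \<notin> bad_areas w"
  shows "very_general (top_of_set (triangle_angles \<phi>)) (\<lambda>\<eta>. inj_on (side_hom \<eta>) (carrier W))"
proof -
  let ?T = "triangle_angles \<phi>"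
  define V where "V w = {\<eta> \<in> ?T. word_act \<phi> w \<eta> \<noteq> (\<lambda>_. 1)}" for w
  define \<G> where "\<G> = V ` {w. distinct_adj w \<and> w \<noteq> []}"
  have count: "countable \<G>"
    unfolding \<G>_def using countable_reduced_words by (rule countable_image)
  \<comment> \<open>A member keeps the intersection inside the space of triangles; an empty family
    would intersect to everything.\<close>
  have "[GP] \<in> {w. distinct_adj w \<and> w \<noteq> []}" by simp
  then have nonempty: "\<G> \<noteq> {}" unfolding \<G>_def by blast
  have op: "openin (top_of_set ?T) (V w)" for w
  proof -
    have 1: "openin (top_of_set ?T) (?T \<inter> (\<lambda>\<eta>. word_act \<phi> w \<eta> y) -` (- {1}))" for y
      by (rule continuous_openin_preimage_gen[OF word_act_continuous]) auto
    have 2: "V w = (\<Union>y. ?T \<inter> (\<lambda>\<eta>. word_act \<phi> w \<eta> y) -` (- {1}))"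
      by (auto simp: V_def fun_eq_iff)
    show ?thesis unfolding 2 by (rule openin_Union) (use 1 in blast)
  qed
  have dense: "dense_in_space (top_of_set ?T) (V w)" if "distinct_adj w" "w \<noteq> []" for w
  proof (rule dense_in_top_of_setI, rule ccontr)
    fix \<eta> and e :: real assume \<eta>: "\<eta> \<in> ?T" "e > 0" "\<not> (\<exists>y\<in>V w \<inter> ?T. dist y \<eta> < e)"
    \<comment> \<open>A ball missing \<open>V w\<close> would make the word act trivially near
      \<eta>, hence also at the equilateral triangle, against the choice of the area.\<close>
    let ?c = "(pi - \<phi>) / 3"
    have eq: "angle_at (?c, ?c, ?c) x = ?c" for x by (cases x) simp_all
    have "(?c, ?c, ?c) \<in> ?T" using \<phi> by (simp add: triangle_angles_def field_simps)
    moreover have "word_act \<phi> w \<eta>' = (\<lambda>_. 1)" if "\<eta>' \<in> ?T" "dist \<eta>' \<eta> < e" for \<eta>'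
      using \<eta>(3) that by (auto simp: V_def)
    ultimately have "word_act \<phi> w (?c, ?c, ?c) = (\<lambda>_. 1)"
      using word_act_identity \<eta> by blast
    then show False
      using good[OF that] \<phi> by (simp add: word_act_def eq bad_areas_def)
  qed
  have "gdelta_in (top_of_set ?T) (\<Inter>\<G>)"
    using count nonempty op by (intro gdelta_in_Inter) (auto simp: \<G>_def open_imp_gdelta_in)
  moreover have "dense_in_space (top_of_set ?T) (\<Inter>\<G>)"
    using Baire_triangle_angles[OF count] op dense by (auto simp: \<G>_def)
  moreover have "inj_on (side_hom \<eta>) (carrier W)" if "\<eta> \<in> \<Inter>\<G>" for \<eta>
  proof (rule side_hom_inj[OF _ \<phi>])
    have *: "\<eta> \<in> V w" if "distinct_adj w" "w \<noteq> []" for w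
      using \<open>\<eta> \<in> \<Inter>\<G>\<close> that by (auto simp: \<G>_def)
    show "\<eta> \<in> ?T" using *[of "[GP]"] by (simp add: V_def)
    show "act (\<lambda>x. kappa \<phi> (angle_at \<eta> x)) w \<noteq> (\<lambda>_. 1)" if "distinct_adj w" "w \<noteq> []" for w
      using *[OF that] by (simp add: V_def word_act_def)
  qed
  ultimately show ?thesis unfolding very_general_def by blast
qed

lemma countable_bad_areas: "countable (\<Union>w\<in>{w. distinct_adj w \<and> w \<noteq> []}. bad_areas w)"
  by (intro countable_UN countable_reduced_words) (auto intro: countable_finite finite_bad_areas)

section \<open>Relations for irrational area\<close>

text \<open>For a half-turn \<open>M\<close> this is, as an isometry, a rotation of size 2 t; up to
  the sign of the matrix, \<open>t\<close> counts modulo pi.\<close>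

definition rot :: "real \<Rightarrow> real^2^2 \<Rightarrow> real^2^2" where
  "rot t M = cos t *\<^sub>R mat 1 + sin t *\<^sub>R M"

lemma rot_add:
  assumes "M ** M = - mat 1"
  shows "rot s M ** rot t M = rot (s + t) M"
proof -
  have "rot s M ** rot t M = (cos s * cos t) *\<^sub>R mat 1 + (cos s * sin t + sin s * cos t) *\<^sub>R M
      + (sin s * sin t) *\<^sub>R (M ** M)"
    by (simp add: rot_def mat2_eq_iff matrix_mult_nth mat_nth algebra_simps)
  then show ?thesis
    unfolding assms by (simp add: rot_def cos_add sin_add mat2_eq_iff mat_nth algebra_simps)
qed

definition eq_pm :: "real^2^2 \<Rightarrow> real^2^2 \<Rightarrow> bool" where
  "eq_pm g h \<longleftrightarrow> g = h \<or> g = - h"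

lemma matrix_mult_minus: "(- M :: real^2^2) ** N = - (M ** N)" "M ** (- N :: real^2^2) = - (M ** N)"
  by (simp_all add: mat2_eq_iff matrix_mult_nth)

lemma eq_pm_mult: "eq_pm g h \<Longrightarrow> eq_pm g' h' \<Longrightarrow> eq_pm (g ** g') (h ** h')"
  by (auto simp: eq_pm_def matrix_mult_minus)

lemma eq_pm_trans: "eq_pm g h \<Longrightarrow> eq_pm h k \<Longrightarrow> eq_pm g k"
  by (auto simp: eq_pm_def)

lemma eq_pm_minus: "eq_pm (- g) h \<longleftrightarrow> eq_pm g h"
  unfolding eq_pm_def by (metis minus_minus)

lemma eq_pm_rot_shift: "eq_pm (rot (t + of_int i * pi) M) (rot t M)"
proof -
  have "cos (of_int i * pi) = (if even i then 1 else - 1)" "sin (of_int i * pi) = 0"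
    using cos_npi_int[of i] sin_npi_int[of i] by (simp_all add: mult.commute)
  then show ?thesis by (simp add: eq_pm_def rot_def cos_add sin_add)
qed

lemma eq_pm_mword_power:
  assumes "M ** M = - mat 1" "eq_pm (mword H u) (rot t M)"
  shows "eq_pm (mword H (concat (replicate n u))) (rot (real n * t) M)"
proof (induction n)
  case 0
  then show ?case by (simp add: mword_def eq_pm_def rot_def)
next
  case (Suc n)
  show ?case
    using eq_pm_mult[OF assms(2) Suc] by (simp add: mword_append rot_add[OF assms(1)] algebra_simps)
qed

text \<open>The sums are multiples of midpoints. The three half-turns carry \<open>L\<close> to
  \<open>M\<close>, \<open>N\<close> and back, so the product lies in the span of
  \<open>mat 1\<close> and \<open>L\<close>.\<close>

lemma triple_product:
  assumes L: "L$2$2 = - L$1$1" "mform L L = 1" and M: "M$2$2 = - M$1$1" "mform M M = 1"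
    and N: "N$2$2 = - N$1$1" "mform N N = 1"
  shows "(N + L) ** (M + N) ** (L + M)
    = (2 * tdet N M L) *\<^sub>R mat 1 - (2 * (1 + mform M N + mform N L + mform L M)) *\<^sub>R L"
  using L(2) M(2) N(2)
  unfolding mat2_eq_iff vector_add_component vector_minus_component vector_scaleR_component
    matrix_mult_nth mat_nth tdet_def trace_2 mform_def L(1) M(1) N(1)
  by (simp add: field_simps) Groebner_Basis.algebra

text \<open>The Minkowski cross product.\<close>

definition bracket :: "real^2^2 \<Rightarrow> real^2^2 \<Rightarrow> real^2^2" where
  "bracket M N = (1 / 2) *\<^sub>R (M ** N - N ** M)"

lemma bracket_square:
  assumes "M$2$2 = - M$1$1" "N$2$2 = - N$1$1"
  shows "bracket M N ** bracket M N = ((mform M N)\<^sup>2 - mform M M * mform N N) *\<^sub>R mat 1"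
  unfolding mat2_eq_iff using assms
  by (simp add: bracket_def matrix_mult_nth mat_nth mform_def field_simps power2_eq_square)

text \<open>Two brackets with a common vector are normals of two lines through a common point, and
  the product of the reflections in these lines is a rotation about that point.\<close>

lemma bracket_mult:
  assumes "L$2$2 = - L$1$1" "M$2$2 = - M$1$1" "N$2$2 = - N$1$1"
  shows "bracket N L ** bracket L M
    = (mform L L * mform M N - mform N L * mform L M) *\<^sub>R mat 1 + tdet N M L *\<^sub>R L"
  unfolding mat2_eq_iff using assms
  by (simp add: bracket_def matrix_mult_nth mat_nth mform_def tdet_def trace_2 field_simps)

context hyperbolic_triangle
begin

definition "\<theta> = (pi - \<phi>) / 2"

definition K :: "complex \<Rightarrow> real^2^2" where
  "K z = - sgn \<delta> *\<^sub>R J z"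

lemma sgn_delta: "sgn \<delta> * sgn \<delta> = 1" "\<delta> = sgn \<delta> * \<bar>\<delta>\<bar>" "sgn \<delta> = 1 \<or> sgn \<delta> = - 1"
  using delta_nonzero by (auto simp: sgn_if)

lemma K_square: "z \<in> H2 \<Longrightarrow> K z ** K z = - mat 1"
  using sgn_delta(3) by (auto simp: K_def matrix_mult_minus half_turn_matrix_square)

text \<open>The product \<open>Q P R\<close> carries \<open>A\<close> around the triangle to itself and rotates about it by the
  angle sum \<open>pi - \<phi> = 2 \<theta>\<close>; the sign in \<open>K\<close> accounts for the orientation of the triangle.\<close>

lemma mword_A: "eq_pm (mword H [GQ, GP, GR]) (rot \<theta> (K A))"
proof -
  have "sqrt (2 * (1 + h GQ)) * sqrt (2 * (1 + h GP)) * sqrt (2 * (1 + h GR))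
      = sqrt (2\<^sup>2 * (2 * ((1 + ha) * (1 + hb) * (1 + hc))))"
    by (simp add: h_def algebra_simps flip: real_sqrt_mult)
  also have "\<dots> = 2 * D" by (simp only: real_sqrt_mult[of "2\<^sup>2"] D_def) simp
  finally have r: "sqrt (2 * (1 + h GQ)) * sqrt (2 * (1 + h GP)) * sqrt (2 * (1 + h GR)) = 2 * D" .
  have "mword H [GQ, GP, GR] = H GQ ** H GP ** H GR"
    by (simp add: mword_def matrix_mul_assoc)
  also have "\<dots> = (1 / (2 * D)) *\<^sub>R (E GQ ** E GP ** E GR)"
    unfolding r[symmetric] by (simp add: H_eq matrix_mult_scaleR mult_ac)
  also have "E GQ ** E GP ** E GR = (2 * \<delta>) *\<^sub>R mat 1 - (2 * S) *\<^sub>R J A"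
    unfolding S_def ha_def hb_def hc_def \<delta>_def E_def gen.case
    by (rule triple_product[OF J_trace _ J_trace _ J_trace]) (simp_all add: mform_J_self H2)
  also have "(1 / (2 * D)) *\<^sub>R \<dots> = (\<delta> / D) *\<^sub>R mat 1 - (S / D) *\<^sub>R J A"
    by (simp add: scaleR_diff_right)
  \<comment> \<open>\<theta> and \<phi>/2 are complementary, which exchanges cosine and
    sine.\<close>
  also have "\<delta> / D = sgn \<delta> * cos \<theta>"
    using sgn_delta(2) half_area(2) by (simp add: \<theta>_def diff_divide_distrib cos_diff)
  also have "S / D = sin \<theta>"
    using half_area(1) by (simp add: \<theta>_def diff_divide_distrib sin_diff)
  also have "(sgn \<delta> * cos \<theta>) *\<^sub>R mat 1 - sin \<theta> *\<^sub>R J A = sgn \<delta> *\<^sub>R rot \<theta> (K A)"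
    using sgn_delta(3) by (auto simp: rot_def K_def algebra_simps)
  finally show ?thesis using sgn_delta(3) by (auto simp: eq_pm_def)
qed

lemma bracket_A: "bracket (J C) (J A) ** bracket (J A) (J B) = (- (sc * sb)) *\<^sub>R rot \<alpha> (K A)"
proof -
  have "bracket (J C) (J A) ** bracket (J A) (J B) = (ha - hb * hc) *\<^sub>R mat 1 + \<delta> *\<^sub>R J A"
    using bracket_mult[OF J_trace[of A] J_trace[of B] J_trace[of C]]
    by (simp add: mform_J_self H2 ha_def hb_def hc_def \<delta>_def)
  also have "ha - hb * hc = - (sc * sb) * cos \<alpha>"
    using cos_angles(1) by (simp add: algebra_simps)
  also have "\<delta> *\<^sub>R J A = (- \<bar>\<delta>\<bar>) *\<^sub>R K A"
    using sgn_delta(2) by (simp add: K_def mult.commute)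
  also have "\<bar>\<delta>\<bar> = (sc * sb) * sin \<alpha>" using sin_angles(1) by (simp add: mult.commute)
  finally show ?thesis by (simp add: rot_def scaleR_add_right)
qed

lemma bracket_square_c: "bracket (J A) (J B) ** bracket (J A) (J B) = sc\<^sup>2 *\<^sub>R mat 1"
  using bracket_square[OF J_trace J_trace, of A B] by (simp add: mform_J_self H2 s2 hc_def)

end

context hyperbolic_triangle
begin

interpretation bca: hyperbolic_triangle B C A \<beta> \<gamma> \<alpha> \<phi> by (rule rotated)
interpretation cab: hyperbolic_triangle C A B \<gamma> \<alpha> \<beta> \<phi> by (rule bca.rotated)

lemma rotated_quantities':
  "bca.K = K" "cab.K = K"
  "bca.sa = sb" "bca.sb = sc" "bca.sc = sa" "cab.sa = sc" "cab.sb = sa" "cab.sc = sb"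
  by (simp_all add: fun_eq_iff K_def bca.K_def cab.K_def
      bca.sa_def bca.sb_def bca.sc_def cab.sa_def cab.sb_def cab.sc_def sa_def sb_def sc_def
      rotated_quantities)

lemma mword_B: "eq_pm (mword H [GR, GQ, GP]) (rot \<theta> (K B))"
proof -
  have "mword H [GR, GQ, GP] = mword bca.H [GQ, GP, GR]"
    by (simp add: mword_def H_def bca.H_def)
  then show ?thesis using bca.mword_A by (simp add: rotated_quantities')
qed

lemma mword_C: "eq_pm (mword H [GP, GR, GQ]) (rot \<theta> (K C))"
proof -
  have "mword H [GP, GR, GQ] = mword cab.H [GQ, GP, GR]"
    by (simp add: mword_def H_def cab.H_def)
  then show ?thesis using cab.mword_A by (simp add: rotated_quantities')
qed

text \<open>The reverse of \<open>[GR, GQ, GP]\<close>. The rotation about \<open>B\<close> enters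
  the relator with exponent 2 - n - l, at most 0, so inverse powers keep all exponents
  natural.\<close>

lemma mword_B_inverse: "eq_pm (mword H [GP, GQ, GR]) (rot (- \<theta>) (K B))"
proof -
  have sq: "H x ** (H x ** M) = - M" for x and M :: "real^2^2"
    by (simp add: matrix_mul_assoc H_square minus_mat_mult)
  have "mword H [GR, GQ, GP] ** mword H [GP, GQ, GR] = - mat 1"
    by (simp add: mword_def sq matrix_mult_minus H_square flip: matrix_mul_assoc)
  then have "eq_pm (mat 1) (rot \<theta> (K B) ** mword H [GP, GQ, GR])"
    using eq_pm_mult[OF mword_B, of "mword H [GP, GQ, GR]" "mword H [GP, GQ, GR]"]
      eq_pm_minus by (metis eq_pm_def)
  then have "eq_pm (rot (- \<theta>) (K B)) ((rot (- \<theta>) (K B) ** rot \<theta> (K B)) ** mword H [GP, GQ, GR])"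
    using eq_pm_mult[of "rot (- \<theta>) (K B)" "rot (- \<theta>) (K B)" "mat 1"]
    by (simp add: eq_pm_def flip: matrix_mul_assoc)
  moreover have "rot 0 (K B) = mat 1" by (simp add: rot_def)
  ultimately show ?thesis
    by (auto simp: rot_add[OF K_square[OF H2(2)]] eq_pm_def)
qed

text \<open>Each rotation is the product of the reflections in two sides, so the product telescopes.\<close>

lemma rot_product: "rot \<alpha> (K A) ** rot \<beta> (K B) ** rot \<gamma> (K C) = - mat 1"
proof -
  let ?a = "bracket (J B) (J C)" and ?b = "bracket (J C) (J A)" and ?c = "bracket (J A) (J B)"
  note br = bracket_A bca.bracket_A cab.bracket_A
  have "(?b ** ?c) ** (?c ** ?a) ** (?a ** ?b) = ?b ** (?c ** ?c) ** (?a ** ?a) ** ?b"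
    by (simp add: matrix_mul_assoc)
  also have "\<dots> = (sa\<^sup>2 * sb\<^sup>2 * sc\<^sup>2) *\<^sub>R mat 1"
    unfolding bracket_square_c bca.bracket_square_c rotated_quantities'
    by (simp add: matrix_mult_scaleR cab.bracket_square_c rotated_quantities' mult_ac)
  finally have "(?b ** ?c) ** (?c ** ?a) ** (?a ** ?b) = (sa\<^sup>2 * sb\<^sup>2 * sc\<^sup>2) *\<^sub>R mat 1" .
  moreover have "(?b ** ?c) ** (?c ** ?a) ** (?a ** ?b)
      = (- (sa\<^sup>2 * sb\<^sup>2 * sc\<^sup>2)) *\<^sub>R (rot \<alpha> (K A) ** rot \<beta> (K B) ** rot \<gamma> (K C))"
    unfolding br rotated_quantities' by (simp add: matrix_mult_minus matrix_mult_scaleR power2_eq_square mult_ac)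
  ultimately have "(sa\<^sup>2 * sb\<^sup>2 * sc\<^sup>2) *\<^sub>R (rot \<alpha> (K A) ** rot \<beta> (K B) ** rot \<gamma> (K C) + mat 1) = 0"
    unfolding scaleR_add_right by (metis add.right_inverse scaleR_minus_left)
  moreover have "sa\<^sup>2 * sb\<^sup>2 * sc\<^sup>2 \<noteq> 0" using s_pos by simp
  ultimately show ?thesis by (simp add: eq_neg_iff_add_eq_0)
qed

end

text \<open>If \<open>n \<theta> = \<alpha>\<close> and \<open>l \<theta> = \<gamma>\<close> modulo \<open>pi\<close>, then \<open>(2 - n - l) \<theta> = \<beta>\<close> since
  \<open>\<alpha> + \<beta> + \<gamma> = 2 \<theta>\<close>; the middle block is a power of the inverse of \<open>R Q P\<close>. For \<open>n = l = 1\<close> the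
  subtraction gives the intended value \<open>0\<close>.\<close>

definition relator :: "nat \<Rightarrow> nat \<Rightarrow> gen list" where
  "relator n l = concat (replicate n [GQ, GP, GR]) @ concat (replicate (n + l - 2) [GP, GQ, GR]) @
     concat (replicate l [GP, GR, GQ])"

lemma (in hyperbolic_triangle) relator_trivial:
  assumes "n > 0" "l > 0" "real n * \<theta> = \<alpha> + of_int i * pi" "real l * \<theta> = \<gamma> + of_int j * pi"
  shows "word_value (side_involution (A, B, C)) (relator n l) = \<one>\<^bsub>PSL2R\<^esub>"
proof -
  have "real (n + l - 2) = real n + real l - 2" using assms(1,2) by (simp add: of_nat_diff)
  moreover have "2 * \<theta> = \<alpha> + \<beta> + \<gamma>" by (simp add: \<theta>_def angle_sum)
  ultimately have "real (n + l - 2) * (- \<theta>) = \<beta> + of_int (- (i + j)) * pi"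
    using assms(3,4) \<open>2 * \<theta> = \<alpha> + \<beta> + \<gamma>\<close> by (simp add: algebra_simps)
  then have "eq_pm (mword H (concat (replicate (n + l - 2) [GP, GQ, GR]))) (rot \<beta> (K B))"
    using eq_pm_mword_power[OF K_square[OF H2(2)] mword_B_inverse, of "n + l - 2"]
      eq_pm_rot_shift eq_pm_trans by metis
  moreover have "eq_pm (mword H (concat (replicate n [GQ, GP, GR]))) (rot \<alpha> (K A))"
    using eq_pm_mword_power[OF K_square[OF H2(1)] mword_A, of n] assms(3)
      eq_pm_rot_shift eq_pm_trans by metis
  moreover have "eq_pm (mword H (concat (replicate l [GP, GR, GQ]))) (rot \<gamma> (K C))"
    using eq_pm_mword_power[OF K_square[OF H2(3)] mword_C, of l] assms(4)
      eq_pm_rot_shift eq_pm_trans by metis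
  ultimately have "eq_pm (mword H (relator n l)) (rot \<alpha> (K A) ** rot \<beta> (K B) ** rot \<gamma> (K C))"
    unfolding relator_def mword_append matrix_mul_assoc by (intro eq_pm_mult)
  then show ?thesis
    unfolding rot_product word_value_one by (auto simp: eq_pm_def)
qed

section \<open>Reduced relators and involutions in W\<close>

lemma concat_replicate_hd_last:
  assumes "n > 0" "u \<noteq> []"
  shows "concat (replicate n u) \<noteq> []" "hd (concat (replicate n u)) = hd u"
    "last (concat (replicate n u)) = last u"
proof -
  obtain m where n: "n = Suc m" using assms(1) by (cases n) auto
  show "concat (replicate n u) \<noteq> []" "hd (concat (replicate n u)) = hd u"
    using assms(2) by (simp_all add: n)
  have "concat (replicate (Suc m) u) = concat (replicate m u) @ u"
    by (induction m) simp_all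
  then show "last (concat (replicate n u)) = last u" using assms(2) by (simp only: n) simp
qed

lemma distinct_adj_concat_replicate:
  assumes "distinct_adj u" "u \<noteq> []" "last u \<noteq> hd u"
  shows "distinct_adj (concat (replicate n u))"
proof (induction n)
  case (Suc n)
  then show ?case
    using assms concat_replicate_hd_last(2)[of n u] by (cases "n = 0") (auto simp: distinct_adj_append_iff)
qed simp

text \<open>All seams join R to P, also when the middle block is empty. The letter Q at both ends
  lets R stand next to the word and its reverse without cancellation.\<close>

lemma relator_reduced:
  assumes "n > 0" "l > 0"
  shows "distinct_adj (relator n l)" "hd (relator n l) = GQ" "last (relator n l) = GQ" "relator n l \<noteq> []"
proof -
  note cr = concat_replicate_hd_last
  have a: "distinct_adj (concat (replicate k [GQ, GP, GR]))"
    "distinct_adj (concat (replicate k [GP, GQ, GR]))" "distinct_adj (concat (replicate k [GP, GR, GQ]))"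
    for k by (rule distinct_adj_concat_replicate; simp)+
  show "hd (relator n l) = GQ" "last (relator n l) = GQ" "relator n l \<noteq> []"
    using cr[OF assms(1), of "[GQ, GP, GR]"] cr[OF assms(2), of "[GP, GR, GQ]"]
    by (simp_all add: relator_def)
  show "distinct_adj (relator n l)"
    using a cr[OF assms(1), of "[GQ, GP, GR]"] cr[OF assms(2), of "[GP, GR, GQ]"]
      cr[of "n + l - 2" "[GP, GQ, GR]"]
    by (cases "n + l - 2 = 0") (simp_all add: relator_def distinct_adj_append_iff)
qed

lemma wclass_ord_2:
  assumes "weq (w @ w) []" "\<not> weq w []"
  shows "group.ord W (wclass w) = 2"
proof -
  interpret group W by (rule group_W)
  have c: "wclass w \<in> carrier W" by (simp add: carrier_W)
  have "wclass w [^]\<^bsub>W\<^esub> (2 :: nat) = \<one>\<^bsub>W\<^esub>"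
    using assms(1) c by (simp add: numeral_2_eq_2 mult_W one_W wclass_eq_iff)
  then have "ord (wclass w) dvd 2" using pow_eq_id[OF c] by simp
  then have "ord (wclass w) = 1 \<or> ord (wclass w) = 2"
    using prime_nat_iff two_is_prime_nat by blast
  moreover have "ord (wclass w) \<noteq> 1"
    using assms(2) ord_eq_1[OF c] by (simp add: one_W wclass_eq_iff)
  ultimately show ?thesis by simp
qed

text \<open>A relator \<open>w\<close> that does not commute with an involution \<open>r\<close> yields the relator
  \<open>(w r w\<^sup>-\<^sup>1) r\<close>, a product of two involutions.\<close>

lemma involution_relation:
  assumes \<eta>: "\<eta> \<in> triangle_angles \<phi>" "0 < \<phi>" "\<phi> < pi"
    and nl: "n > 0" "l > 0"
    and ang: "real n * ((pi - \<phi>) / 2) = fst \<eta> + of_int i * pi"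
      "real l * ((pi - \<phi>) / 2) = snd (snd \<eta>) + of_int j * pi"
  shows "\<exists>u \<in> kernel W PSL2R (side_hom \<eta>). u \<noteq> \<one>\<^bsub>W\<^esub> \<and>
    (\<exists>s\<in>carrier W. \<exists>t\<in>carrier W. group.ord W s = 2 \<and> group.ord W t = 2 \<and> u = s \<otimes>\<^bsub>W\<^esub> t)"
proof -
  from side_hom_triangle[OF \<eta>] obtain A B C \<alpha> \<beta> \<gamma> where eq: "\<eta> = (\<alpha>, \<beta>, \<gamma>)"
    and "hyperbolic_triangle A B C \<alpha> \<beta> \<gamma> \<phi>"
    and hom: "side_hom \<eta> = rep_of (side_involution (A, B, C))" .
  then interpret hyperbolic_triangle A B C \<alpha> \<beta> \<gamma> \<phi> by simp
  interpret PSL: group PSL2R by (rule group_PSL2R)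
  let ?f = "side_involution (A, B, C)"
  note val = side_involution_closed side_involution_square
  note closed = word_value_closed[where f = ?f, OF val]
    and append = word_value_append[where f = ?f, OF val]
    and value_weq = word_value_weq[where f = ?f, OF val]
  define w where "w = relator n l"
  have w1: "word_value ?f w = \<one>\<^bsub>PSL2R\<^esub>"
    unfolding w_def using relator_trivial[OF nl] ang by (simp add: eq \<theta>_def)
  have "word_value ?f (rev w @ w) = word_value ?f []" by (rule value_weq[OF weq_rev])
  then have "word_value ?f (rev w) \<otimes>\<^bsub>PSL2R\<^esub> word_value ?f w = \<one>\<^bsub>PSL2R\<^esub>"
    by (simp add: append) (simp add: word_value_def)
  then have w2: "word_value ?f (rev w) = \<one>\<^bsub>PSL2R\<^esub>"
    using closed[of "rev w"] by (simp add: w1)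
  have "weq ([GR] @ [GR]) []" using weq.cancel[of "[]" GR "[]"] by simp
  then have "word_value ?f ([GR] @ [GR]) = word_value ?f []" by (rule value_weq)
  then have r: "word_value ?f [GR] \<otimes>\<^bsub>PSL2R\<^esub> word_value ?f [GR] = \<one>\<^bsub>PSL2R\<^esub>"
    unfolding append by (simp add: word_value_def)
  define s where "s = w @ [GR] @ rev w"
  have "word_value ?f (s @ [GR]) = \<one>\<^bsub>PSL2R\<^esub>"
    unfolding s_def append w1 w2 using closed[of "[GR]"] r by simp
  have red: "distinct_adj s" "distinct_adj (s @ [GR])" "s \<noteq> []"
    using relator_reduced[OF nl] unfolding s_def w_def
    by (auto simp: distinct_adj_append_iff distinct_adj_Cons hd_rev last_rev)
  have "weq (rev w @ w) []" by (rule weq_rev)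
  from weq_append1[OF weq_append2[OF this], of "w @ [GR]" "[GR] @ rev w"]
  have "weq (s @ s) (w @ [GR, GR] @ rev w)" by (simp add: s_def)
  moreover have "weq (w @ [GR, GR] @ rev w) (w @ rev w)" by (rule weq.cancel)
  moreover have "weq (w @ rev w) []" using weq_rev[of "rev w"] by simp
  ultimately have ss: "weq (s @ s) []" by (meson weq.trans)
  have "group.ord W (wclass s) = 2"
    using wclass_ord_2[OF ss reduced_not_weq_Nil] red by simp
  moreover have "group.ord W (wclass [GR]) = 2"
    using wclass_ord_2[OF \<open>weq ([GR] @ [GR]) []\<close> reduced_not_weq_Nil] by simp
  moreover have "wclass (s @ [GR]) \<noteq> \<one>\<^bsub>W\<^esub>"
    using reduced_not_weq_Nil[OF red(2)] by (simp add: one_W wclass_eq_iff)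
  moreover have "wclass (s @ [GR]) \<in> kernel W PSL2R (side_hom \<eta>)"
    using \<open>word_value ?f (s @ [GR]) = \<one>\<^bsub>PSL2R\<^esub>\<close>
    by (simp add: kernel_def hom rep_of_wclass[where f = ?f, OF val] carrier_W)
  ultimately show ?thesis
    using mult_W[of s "[GR]"] carrier_W by (metis rangeI)
qed

section \<open>Density of the triangles with a relation\<close>

lemma multiples_dense_mod_pi:
  assumes "t / pi \<notin> \<rat>" "d > 0"
  obtains n :: nat and i :: int where "n > 0" "\<bar>real n * t - of_int i * pi - a\<bar> < d"
proof -
  \<comment> \<open>Kronecker's theorem with positive \<open>k\<close>, since the multiples become
    exponents in the relator.\<close>
  obtain i k :: int where k: "k > 0" "\<bar>of_int k * (t / pi) - of_int i - a / pi\<bar> < d / pi"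
    by (rule sequence_of_fractional_parts_is_dense[OF assms(1), of "d / pi" "a / pi"])
      (use assms(2) in auto)
  have "\<bar>real (nat k) * t - of_int i * pi - a\<bar> = \<bar>of_int k * (t / pi) - of_int i - a / pi\<bar> * pi"
  proof -
    have "real (nat k) * t - of_int i * pi - a = (of_int k * (t / pi) - of_int i - a / pi) * pi"
      using k(1) by (simp add: left_diff_distrib)
    then show ?thesis by (simp add: abs_mult)
  qed
  also have "\<dots> < d" using k(2) by (simp add: field_simps)
  finally show ?thesis using that[of "nat k" i] k(1) by simp
qed

lemma dense_involution_relation:
  assumes "0 < \<phi>" "\<phi> < pi" "\<phi> / pi \<notin> \<rat>"
  shows "dense_in_space (top_of_set (triangle_angles \<phi>))
    {\<eta> \<in> triangle_angles \<phi>. \<exists>u \<in> kernel W PSL2R (side_hom \<eta>). u \<noteq> \<one>\<^bsub>W\<^esub> \<and>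
      (\<exists>s\<in>carrier W. \<exists>t\<in>carrier W. group.ord W s = 2 \<and> group.ord W t = 2 \<and> u = s \<otimes>\<^bsub>W\<^esub> t)}"
proof (rule dense_in_top_of_setI)
  fix \<eta> :: "real \<times> real \<times> real" and e :: real
  assume "\<eta> \<in> triangle_angles \<phi>" "e > 0"
  then obtain a b c where \<eta>: "\<eta> = (a, b, c)" and pos: "0 < a" "0 < b" "0 < c"
    and sum: "a + b + c = pi - \<phi>"
    by (auto simp: triangle_angles_def)
  define t where "t = (pi - \<phi>) / 2"
  have "\<phi> / pi = 1 - 2 * (t / pi)" by (simp add: t_def diff_divide_distrib)
  then have t: "t / pi \<notin> \<rat>"
    using assms(3) Rats_diff[OF Rats_1 Rats_mult[OF Rats_number_of]] by metis
  \<comment> \<open>\<open>b'\<close> carries both errors, so the total stays below 4 d; half of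
    each angle keeps \<open>b'\<close> positive too.\<close>
  define d where "d = min (e / 4) (min (min a b) c / 2)"
  have d: "d > 0" "d \<le> e / 4" "d \<le> a / 2" "d \<le> b / 2" "d \<le> c / 2"
    using pos \<open>e > 0\<close> by (auto simp: d_def)
  obtain n i where n: "n > 0" "\<bar>real n * t - of_int i * pi - a\<bar> < d"
    using multiples_dense_mod_pi[OF t d(1)] .
  obtain l j where l: "l > 0" "\<bar>real l * t - of_int j * pi - c\<bar> < d"
    using multiples_dense_mod_pi[OF t d(1)] .
  define a' where "a' = real n * t - of_int i * pi"
  define c' where "c' = real l * t - of_int j * pi"
  define b' where "b' = pi - \<phi> - a' - c'"
  have near: "\<bar>a' - a\<bar> < d" "\<bar>c' - c\<bar> < d" "\<bar>b' - b\<bar> < 2 * d"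
    using n l sum by (auto simp: a'_def c'_def b'_def)
  then have "0 < a'" "0 < b'" "0 < c'" using d by auto
  moreover have "a' + b' + c' = pi - \<phi>" by (simp add: b'_def)
  ultimately have T: "(a', b', c') \<in> triangle_angles \<phi>"
    using assms(1) by (auto simp: triangle_angles_def)
  have "dist (a', b', c') \<eta> \<le> \<bar>a' - a\<bar> + (\<bar>b' - b\<bar> + \<bar>c' - c\<bar>)"
    unfolding \<eta> dist_Pair_Pair dist_real_def
    using sqrt_sum_squares_le_sum_abs[of "\<bar>a' - a\<bar>" "sqrt (\<bar>b' - b\<bar>\<^sup>2 + \<bar>c' - c\<bar>\<^sup>2)"]
      sqrt_sum_squares_le_sum_abs[of "\<bar>b' - b\<bar>" "\<bar>c' - c\<bar>"] by simp
  also have "\<dots> < e" using near d by auto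
  finally show "\<exists>\<eta>'\<in>{\<eta> \<in> triangle_angles \<phi>. \<exists>u \<in> kernel W PSL2R (side_hom \<eta>). u \<noteq> \<one>\<^bsub>W\<^esub> \<and>
      (\<exists>s\<in>carrier W. \<exists>t\<in>carrier W. group.ord W s = 2 \<and> group.ord W t = 2 \<and> u = s \<otimes>\<^bsub>W\<^esub> t)}
      \<inter> triangle_angles \<phi>. dist \<eta>' \<eta> < e"
    using involution_relation[OF T assms(1,2) n(1) l(1), of i j] T
    by (intro bexI[of _ "(a', b', c')"]) (simp_all add: a'_def c'_def t_def)
qed

theorem corollary1p7:
  shows "(\<exists>N. countable N \<and>
            (\<forall>\<phi>\<in>{0<..<pi} - N.
               very_general (top_of_set (triangle_angles \<phi>))
                 (\<lambda>\<eta>. inj_on (side_hom \<eta>) (carrier W)))) \<and>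
         (\<forall>\<phi>\<in>{0<..<pi}. \<phi> / pi \<notin> \<rat> \<longrightarrow>
            dense_in_space (top_of_set (triangle_angles \<phi>))
              {\<eta> \<in> triangle_angles \<phi>.
                 \<exists>u \<in> kernel W PSL2R (side_hom \<eta>). u \<noteq> \<one>\<^bsub>W\<^esub> \<and>
                   (\<exists>s\<in>carrier W. \<exists>t\<in>carrier W.
                      group.ord W s = 2 \<and> group.ord W t = 2 \<and> u = s \<otimes>\<^bsub>W\<^esub> t)})"
proof (intro conjI exI[of _ "\<Union>w\<in>{w. distinct_adj w \<and> w \<noteq> []}. bad_areas w"] ballI impI)
  show "countable (\<Union>w\<in>{w. distinct_adj w \<and> w \<noteq> []}. bad_areas w)"
    by (rule countable_bad_areas)
qed (use very_general_injective dense_involution_relation in auto)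

end
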